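(* Let $\mathcal{P}$ be an order-hereditary, $i$-monotone property of $k$-colourings of complete graphs defined by forbidden colourings on at most $N$ vertices, with $\mathcal{P}_n\neq\emptyset$ for every $n$. Let $p=p(n)\in[0,1]$ satisfy $p\gg n^{-1/(2\binom N2-1)}$, and let $T$ denote an instance of the $p$-random template $T_{n,p}(i)$. For any fixed $\varepsilon>0$, with high probability $$p\left(\mathrm{ex}(n,\mathcal{P})-\varepsilon n^2\right)\le\mathrm{ex}(T,\mathcal{P})\le p\left(\mathrm{ex}(n,\mathcal{P})+2\varepsilon n^2\right).$$
   Context: $k\ge2$ is a fixed integer, $[k]=\{1,\dots,k\}$ and $i\in[k]$ is a fixed colour. $K_n$ is the complete graph on $[n]$. A $k$-colouring of $K_n$ is a function $c:E(K_n)\to[k]$. For $A=\{a_1<\dots<a_m\}\subseteq[n]$, $c_{|A}$ is the $k$-colouring of $K_m$ with $c_{|A}(jl)=c(a_ja_l)$. An order-hereditary property is a sequence $\mathcal{P}=(\mathcal{P}_n)_n$ with $\mathcal{P}_n$ a set of $k$-colourings of $K_n$ such that $c_{|A}\in\mathcal{P}_{|A|}$ whenever $c\in\mathcal{P}_n$, $A\subseteq[n]$. It is defined by forbidden colourings on at most $N$ vertices if there is a set $\mathcal{F}$ of $k$-colourings of complete graphs $K_m$, $m\le N$, such that $c\in\mathcal{P}_n$ if and only if $c_{|A}\notin\mathcal{F}$ for all $A\subseteq[n]$. It is $i$-monotone (monotone with respect to colour $i$) if whenever $c\in\mathcal{P}_n$ and $e\in E(K_n)$, the colouring obtained from $c$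 by changing the colour of $e$ to $i$ also lies in $\mathcal{P}_n$. A template for $K_n$ is a function $t$ assigning to each edge a nonempty set $t(e)\subseteq[k]$; $\langle t\rangle$ is the set of $k$-colourings $c$ with $c(e)\in t(e)$ for all $e$; $\mathrm{Ent}(t)=\sum_e\log_k|t(e)|$. $\mathrm{ex}(n,\mathcal{P})=\max\{\mathrm{Ent}(t):\langle t\rangle\subseteq\mathcal{P}_n\}$. For a template $t$ for $K_n$ with $i\in t(e)$ for all $e$, $\mathrm{ex}(t,\mathcal{P})=\max\{\mathrm{Ent}(t'): t'\text{ a template for }K_n,\ t'(e)\subseteq t(e)\ \forall e,\ \langle t'\rangle\subseteq\mathcal{P}_n\}$. The $p$-random template $T_{n,p}(i)$ has, independently for each edge $e$, $T_{n,p}(i)(e)=[k]$ with probability $p$ and $=\{i\}$ otherwise. "With high probability" means with probability tending to $1$ as $n\to\infty$; $f\gg g$ means $g/f\to0$. *)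

theory Defs
  imports "HOL-Probability.Probability" "HOL-Probability.Product_PMF" "HOL-Library.Landau_Symbols"
begin

text \<open>Functions on the edges of the complete graph on \<open>{1..n}\<close> (colourings and templates) are
  extensional, i.e. \<open>undefined\<close> outside the edge set, so that equality of colourings is equality
  of HOL functions.\<close>

type_synonym colouring = "nat set \<Rightarrow> nat"
type_synonym template = "nat set \<Rightarrow> nat set"

definition edges :: "nat \<Rightarrow> nat set set" where
  "edges n = {e. e \<subseteq> {1..n} \<and> card e = 2}"

definition colourings :: "nat \<Rightarrow> nat \<Rightarrow> colouring set" where
  "colourings k n = (edges n \<rightarrow>\<^sub>E {1..k})"

text \<open>For finite \<open>A = {a\<^sub>1 < \<dots> < a\<^sub>m}\<close>, \<open>nth_elem A j = a\<^sub>j\<close> with indices starting at \<open>1\<close>.\<close>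

definition nth_elem :: "nat set \<Rightarrow> nat \<Rightarrow> nat" where
  "nth_elem A j = sorted_list_of_set A ! (j - 1)"

definition col_restrict :: "colouring \<Rightarrow> nat set \<Rightarrow> colouring" where
  "col_restrict c A = (\<lambda>e\<in>edges (card A). c (nth_elem A ` e))"

definition order_hereditary :: "nat \<Rightarrow> (nat \<Rightarrow> colouring set) \<Rightarrow> bool" where
  "order_hereditary k P \<longleftrightarrow>
     (\<forall>n. P n \<subseteq> colourings k n) \<and>
     (\<forall>n. \<forall>c\<in>P n. \<forall>A\<subseteq>{1..n}. col_restrict c A \<in> P (card A))"

text \<open>The forbidden family is graded by the number \<open>m\<close> of vertices, because the empty colourings
  of the complete graphs on \<open>0\<close> and on \<open>1\<close> vertices are the same HOL function.\<close>

definition defined_by_forbidden :: "nat \<Rightarrow> nat \<Rightarrow> (nat \<Rightarrow> colouring set) \<Rightarrow> bool" where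
  "defined_by_forbidden k N P \<longleftrightarrow>
     (\<exists>F. (\<forall>m. F m \<subseteq> colourings k m) \<and> (\<forall>m>N. F m = {}) \<and>
          (\<forall>n. \<forall>c\<in>colourings k n.
             c \<in> P n \<longleftrightarrow> (\<forall>A\<subseteq>{1..n}. col_restrict c A \<notin> F (card A))))"

definition colour_monotone :: "nat \<Rightarrow> (nat \<Rightarrow> colouring set) \<Rightarrow> bool" where
  "colour_monotone i P \<longleftrightarrow> (\<forall>n. \<forall>c\<in>P n. \<forall>e\<in>edges n. c(e := i) \<in> P n)"

definition templates :: "nat \<Rightarrow> nat \<Rightarrow> template set" where
  "templates k n = (edges n \<rightarrow>\<^sub>E {S. S \<noteq> {} \<and> S \<subseteq> {1..k}})"

definition realisations :: "nat \<Rightarrow> nat \<Rightarrow> template \<Rightarrow> colouring set" where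
  "realisations k n t = {c \<in> colourings k n. \<forall>e\<in>edges n. c e \<in> t e}"

definition Ent :: "nat \<Rightarrow> nat \<Rightarrow> template \<Rightarrow> real" where
  "Ent k n t = (\<Sum>e\<in>edges n. log (real k) (real (card (t e))))"

text \<open>The sets below are finite. The first is nonempty as soon as \<open>P n\<close> is; the second is nonempty
  if moreover \<open>P\<close> is monotone with respect to a colour \<open>i\<close> belonging to every \<open>t e\<close> (then the
  constant colouring \<open>i\<close> gives an admissible template).\<close>

definition ex_ent :: "nat \<Rightarrow> nat \<Rightarrow> (nat \<Rightarrow> colouring set) \<Rightarrow> real" where
  "ex_ent k n P = Max {Ent k n t | t. t \<in> templates k n \<and> realisations k n t \<subseteq> P n}"

definition ex_ent_rel :: "nat \<Rightarrow> nat \<Rightarrow> template \<Rightarrow> (nat \<Rightarrow> colouring set) \<Rightarrow> real" where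
  "ex_ent_rel k n t P =
     Max {Ent k n t' | t'. t' \<in> templates k n \<and> (\<forall>e\<in>edges n. t' e \<subseteq> t e) \<and>
                           realisations k n t' \<subseteq> P n}"

definition random_template :: "nat \<Rightarrow> nat \<Rightarrow> nat \<Rightarrow> real \<Rightarrow> template pmf" where
  "random_template k i n p =
     Pi_pmf (edges n) undefined
       (\<lambda>_. map_pmf (\<lambda>b. if b then {1..k} else {i}) (bernoulli_pmf p))"

end

theory Submission
  imports Defs "HOL-Real_Asymp.Real_Asymp"
begin

text \<open>A template with all realisations in \<open>P\<close> is an independent set in the hypergraph on pairs (edge, colour)
  whose edges are the graphs of the forbidden colourings of \<open>N\<close>-sets. A container theorem for this
  hypergraph covers all such templates by \<open>exp (o (p n\<^sup>2))\<close> templates containing few forbidden copies,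
  and averaging over subsets of bounded size (supersaturation) shows that each of these has entropy at
  most \<open>ex_ent k n P + \<epsilon> n\<^sup>2\<close>. A Chernoff bound and the union bound over the containers give the upper
  bound. For the lower bound, intersect an extremal template, with \<open>i\<close> added to every edge, with the
  random one.

  Only degrees and codegrees of pairs enter the container argument: codegrees are smaller than degrees by
  a factor \<open>n\<close>, so fingerprints of density \<open>q\<close> suffice as soon as \<open>q ^ (r - 1) \<ge> 1 / n\<close> where
  \<open>r = N choose 2\<close>. The choice \<open>q = n powr (-2 / (2 r - 1))\<close> satisfies this and is smaller than \<open>p\<close> by a
  power of \<open>n\<close>, which absorbs the logarithm in the number of containers.\<close>

section \<open>Containers for uniform hypergraphs\<close>

text \<open>The container theorem is proved as a covering statement: it yields a family of sets, not
  a map from fingerprints to containers. Instead of following an ordering of the vertices by degree,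
  the proof branches over every vertex that could be picked next and counts the branches;
  \<open>b\<close> picks at each of \<open>j\<close> levels give
  \<open>(card V + 1) ^ (b * j)\<close> of them. The parameters \<open>v\<close> and
  \<open>d\<close> are upper bounds for the number of vertices and for the degrees. They stay fixed
  when vertices are deleted, so weights are always measured against the same product
  \<open>v * d\<close>, and the removal of sets of size \<open>\<alpha> * v\<close> has to stop
  after about \<open>1 / \<alpha>\<close> rounds. The hypergraph must be uniform, while forbidden
  colourings may have different sizes; hence they are all brought to exactly \<open>N\<close>
  vertices by enlarging their vertex sets.\<close>

text \<open>A weighted hypergraph is a function \<open>h\<close> on sets, zero off its edges; \<open>I\<close> is independent if
  \<open>h\<close> vanishes on all subsets of \<open>I\<close>.\<close>

definition wdeg :: "'a set \<Rightarrow> ('a set \<Rightarrow> real) \<Rightarrow> 'a set \<Rightarrow> real" where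
  "wdeg V h F = (\<Sum>E | E \<subseteq> V \<and> F \<subseteq> E. h E)"

text \<open>The value \<open>0\<close> for \<open>u \<in> B\<close> matters: there
  \<open>insert u B = B\<close>, and an edge through \<open>u\<close> would survive in the link with
  its old uniformity.\<close>

definition link :: "('a set \<Rightarrow> real) \<Rightarrow> 'a \<Rightarrow> 'a set \<Rightarrow> real" where
  "link h u B = (if u \<in> B then 0 else h (insert u B))"

lemma wdeg_mono:
  assumes "finite V" "V' \<subseteq> V" "\<And>E. 0 \<le> h E" "F' \<subseteq> F"
  shows "wdeg V' h F \<le> wdeg V h F'"
  unfolding wdeg_def using assms by (intro sum_mono2) auto

lemma wdeg_nonneg: "(\<And>E. 0 \<le> h E) \<Longrightarrow> 0 \<le> wdeg V h F"
  unfolding wdeg_def by (intro sum_nonneg) auto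

lemma wdeg_le_wdeg: "(\<And>E. h E \<le> h' E) \<Longrightarrow> wdeg V h F \<le> wdeg V h' F"
  unfolding wdeg_def by (intro sum_mono) auto

lemma wdeg_add: "wdeg V (\<lambda>E. h E + h' E) F = wdeg V h F + wdeg V h' F"
  unfolding wdeg_def by (rule sum.distrib)

lemma wdeg_sum: "wdeg V (\<lambda>E. \<Sum>u\<in>U. h u E) F = (\<Sum>u\<in>U. wdeg V (h u) F)"
  unfolding wdeg_def by (rule sum.swap)

lemma wdeg_outside: "\<not> F \<subseteq> V \<Longrightarrow> wdeg V h F = 0"
  unfolding wdeg_def by (rule sum.neutral) auto

lemma wdeg_link:
  assumes "finite V" "u \<in> V"
  shows "wdeg V (link h u) F = (if u \<in> F then 0 else wdeg V h (insert u F))"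
proof (cases "u \<in> F")
  case True
  then show ?thesis unfolding wdeg_def link_def by (auto intro!: sum.neutral)
next
  case False
  have "wdeg V (link h u) F = (\<Sum>B | (B \<subseteq> V \<and> F \<subseteq> B) \<and> u \<notin> B. h (insert u B))"
    unfolding wdeg_def link_def
    using assms(1) by (intro sum.mono_neutral_cong_right) auto
  also have "\<dots> = wdeg V h (insert u F)"
    unfolding wdeg_def
    by (rule sum.reindex_bij_witness[where i = "\<lambda>E. E - {u}" and j = "insert u"])
      (use assms False in auto)
  finally show ?thesis using False by simp
qed

text \<open>Double counting: an edge containing \<open>F\<close> is counted once for each of its
  \<open>r - card F\<close> further vertices. For \<open>F = {x, y}\<close> this is why codegrees
  summed over a third vertex grow only by a constant factor.\<close>

lemma sum_wdeg_insert:
  assumes "finite V" "F \<subseteq> V" "\<And>E. h E \<noteq> 0 \<Longrightarrow> card E = r"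
  shows "(\<Sum>x\<in>V - F. wdeg V h (insert x F)) = real (r - card F) * wdeg V h F"
proof -
  have "(\<Sum>x\<in>V - F. wdeg V h (insert x F)) =
        (\<Sum>x\<in>V - F. \<Sum>E | E \<subseteq> V \<and> F \<subseteq> E. if x \<in> E then h E else 0)"
    unfolding wdeg_def using assms(1)
    by (intro sum.cong refl sum.mono_neutral_cong_left) auto
  also have "\<dots> = (\<Sum>E | E \<subseteq> V \<and> F \<subseteq> E. \<Sum>x\<in>V - F. if x \<in> E then h E else 0)"
    by (rule sum.swap)
  also have "\<dots> = (\<Sum>E | E \<subseteq> V \<and> F \<subseteq> E. real (r - card F) * h E)"
  proof (rule sum.cong[OF refl])
    fix E assume E: "E \<in> {E. E \<subseteq> V \<and> F \<subseteq> E}"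
    have "(\<Sum>x\<in>V - F. if x \<in> E then h E else 0) = real (card (E - F)) * h E"
      using assms(1) E by (subst sum.inter_restrict[symmetric]) (auto intro!: arg_cong[where f=card])
    moreover have "h E \<noteq> 0 \<Longrightarrow> card (E - F) = r - card F"
      using assms E by (metis (no_types, lifting) card_Diff_subset finite_subset mem_Collect_eq)
    ultimately show "(\<Sum>x\<in>V - F. if x \<in> E then h E else 0) = real (r - card F) * h E"
      by (cases "h E = 0") auto
  qed
  finally show ?thesis unfolding wdeg_def by (simp add: sum_distrib_left)
qed

lemma sum_wdeg_singleton:
  assumes "finite V" "\<And>E. h E \<noteq> 0 \<Longrightarrow> card E = r"
  shows "(\<Sum>x\<in>V. wdeg V h {x}) = real r * wdeg V h {}"
  using sum_wdeg_insert[of V "{}" h r] assms by simp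

text \<open>Base of the induction on uniformity. The vertices that carry a weighted singleton miss
  every independent set, and since each contributes at most \<open>d\<close> to a total of
  \<open>c * v * d\<close>, there are at least \<open>c * v\<close> of them.\<close>

lemma avoiding_set_uniform_1:
  fixes c :: real
  assumes c: "0 < c"
    and "finite V" "0 < v" "\<And>E. 0 \<le> h E" "\<And>E. h E \<noteq> 0 \<Longrightarrow> card E = 1"
    "0 < d" "\<And>x. wdeg V h {x} \<le> d" "c * v * d \<le> wdeg V h {}"
  shows "\<exists>W. W \<subseteq> V \<and> c * v \<le> real (card W) \<and> (\<forall>I\<subseteq>V. (\<forall>E\<subseteq>I. h E = 0) \<longrightarrow> W \<inter> I = {})"
proof (intro exI conjI allI impI)
  let ?W = "{x\<in>V. h {x} \<noteq> 0}"
  show "?W \<subseteq> V" by auto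
  have z: "wdeg V h {x} = 0" if "x \<in> V - ?W" for x
    unfolding wdeg_def
  proof (rule sum.neutral, safe)
    fix E assume "{x} \<subseteq> E"
    with assms(5)[of E] that show "h E = 0" by (auto simp: card_1_singleton_iff)
  qed
  have "c * v * d \<le> (\<Sum>x\<in>V. wdeg V h {x})"
    using assms sum_wdeg_singleton[of V h 1] by simp
  also have "\<dots> = (\<Sum>x\<in>?W. wdeg V h {x})"
    using assms(2) z by (intro sum.mono_neutral_right) auto
  also have "\<dots> \<le> real (card ?W) * d"
    using assms(7) by (intro sum_bounded_above) auto
  finally show "c * v \<le> real (card ?W)" using assms(6) by simp
  show "?W \<inter> I = {}" if "\<forall>E\<subseteq>I. h E = 0" for I using that by auto
qed

text \<open>Counts the branches at one step: at most \<open>n\<close> choices of the next vertex,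
  and the single set \<open>x\<close> of the branch that stops.\<close>

lemma card_insert_UN_le:
  assumes "finite H" "\<And>u. u \<in> H \<Longrightarrow> card (f u) \<le> M" "card H \<le> n" "1 \<le> M"
  shows "card (insert x (\<Union>u\<in>H. f u)) \<le> (n + 1) * M"
proof -
  have "card (insert x (\<Union>u\<in>H. f u)) \<le> 1 + card (\<Union>u\<in>H. f u)"
    by (cases "finite (\<Union>u\<in>H. f u)") (auto simp: card_insert_if)
  also have "card (\<Union>u\<in>H. f u) \<le> (\<Sum>u\<in>H. card (f u))" by (rule card_UN_le[OF assms(1)])
  also have "\<dots> \<le> card H * M" using sum_bounded_above[of H "\<lambda>u. card (f u)" M] assms by simp
  also have "\<dots> \<le> n * M" using assms by simp
  finally show ?thesis using assms by (simp add: algebra_simps)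
qed

text \<open>A budget in quarters of \<open>c * v * d\<close>. Discarding the edges that meet
  \<open>X\<close> costs at most one quarter; of the remaining degree sum, \<open>U\<close> carries
  at most one quarter and the vertices of degree below \<open>c / 4 * d\<close> at most another. The
  last quarter sits on the wanted vertices, at most \<open>d\<close> on each.\<close>

lemma many_high_degree:
  fixes c d v :: real
  assumes fin: "finite V" and cv: "real (card V) \<le> v" and h0: "\<And>E. 0 \<le> h E"
    and hJ: "\<And>E. h E \<noteq> 0 \<Longrightarrow> card E = J" and J: "1 \<le> J"
    and d: "0 < d" and c: "0 < c" and hd: "\<And>x. wdeg V h {x} \<le> d"
    and tot: "c * v * d \<le> wdeg V h {}"
    and X: "X \<subseteq> V" "real (card X) \<le> c * v / 4" and U: "U \<subseteq> V" "real (card U) \<le> c * v / 4"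
  defines "h' \<equiv> (\<lambda>E. if E \<inter> X = {} then h E else 0)"
  shows "c * v / 4 \<le> real (card {u \<in> V - U. c / 4 * d \<le> wdeg V h' {u}})"
proof -
  let ?H = "{u \<in> V - U. c / 4 * d \<le> wdeg V h' {u}}"
  have h'0: "0 \<le> h' E" for E using h0 by (simp add: h'_def)
  have h'd: "wdeg V h' {u} \<le> d" for u
    using hd[of u] wdeg_le_wdeg[of h' h V "{u}"] h0 by (fastforce simp: h'_def)
  have "wdeg V h {} \<le> wdeg V h' {} + (\<Sum>x\<in>X. wdeg V h {x})"
  proof -
    have "h E \<le> h' E + (\<Sum>x\<in>X. if x \<in> E then h E else 0)" if "E \<subseteq> V" for E
    proof (cases "E \<inter> X = {}")
      case True
      then show ?thesis using h0 by (auto simp: h'_def intro!: sum_nonneg)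
    next
      case False
      then obtain x where x: "x \<in> E" "x \<in> X" by auto
      have "h E = (\<Sum>x\<in>{x}. if x \<in> E then h E else 0)" using x by simp
      also have "\<dots> \<le> (\<Sum>x\<in>X. if x \<in> E then h E else 0)"
        using x h0 X(1) fin finite_subset by (intro sum_mono2) auto
      finally show ?thesis using h'0[of E] by simp
    qed
    hence "wdeg V h {} \<le> (\<Sum>E | E \<subseteq> V \<and> {} \<subseteq> E. h' E + (\<Sum>x\<in>X. if x \<in> E then h E else 0))"
      unfolding wdeg_def by (intro sum_mono) auto
    also have "\<dots> = wdeg V h' {} + (\<Sum>x\<in>X. \<Sum>E | E \<subseteq> V \<and> {} \<subseteq> E. if x \<in> E then h E else 0)"
      unfolding wdeg_def sum.distrib by (subst (2) sum.swap) simp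
    also have "(\<Sum>x\<in>X. \<Sum>E | E \<subseteq> V \<and> {} \<subseteq> E. if x \<in> E then h E else 0) = (\<Sum>x\<in>X. wdeg V h {x})"
      unfolding wdeg_def using fin by (intro sum.cong refl sum.mono_neutral_cong_right) auto
    finally show ?thesis .
  qed
  moreover have "(\<Sum>x\<in>X. wdeg V h {x}) \<le> real (card X) * d"
    using hd by (intro sum_bounded_above) auto
  moreover have "real (card X) * d \<le> c * v / 4 * d" using X d by (intro mult_right_mono) auto
  ultimately have 1: "3 / 4 * (c * v * d) \<le> wdeg V h' {}" using tot by simp
  \<comment> \<open>Passing from the total weight to the degree sum only gains, since every edge has
    \<open>J \<ge> 1\<close> vertices.\<close>
  have "wdeg V h' {} \<le> real J * wdeg V h' {}"
    using J wdeg_nonneg[of h' V "{}"] h'0 mult_right_mono[of 1 "real J" "wdeg V h' {}"] by simp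
  also have "\<dots> = (\<Sum>x\<in>V. wdeg V h' {x})"
    by (rule sum_wdeg_singleton[symmetric, OF fin]) (use hJ in \<open>auto simp: h'_def split: if_splits\<close>)
  also have "\<dots> \<le> (\<Sum>x\<in>V. (if x \<in> U then d else 0) + (if x \<in> ?H then d else 0) + c / 4 * d)"
    using h'd c d by (intro sum_mono) (auto simp: add_nonneg_nonneg intro: add_increasing2)
  also have "\<dots> = real (card U) * d + real (card ?H) * d + real (card V) * (c / 4 * d)"
  proof -
    have "(\<Sum>x\<in>V. if x \<in> B then d else 0) = real (card B) * d" if "B \<subseteq> V" for B
      using that fin by (simp add: sum.inter_restrict[symmetric] Int_absorb1)
    from this[of U] this[of ?H] U show ?thesis unfolding sum.distrib by auto
  qed
  also have "\<dots> \<le> c * v / 4 * d + real (card ?H) * d + v * (c / 4 * d)"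
    using U cv c d by (intro add_mono mult_right_mono) auto
  finally have "3 / 4 * (c * v * d) \<le> c * v / 2 * d + real (card ?H) * d" using 1 by (simp add: algebra_simps)
  hence "c * v / 4 * d \<le> real (card ?H) * d" by (simp add: algebra_simps)
  thus ?thesis using d by simp
qed

text \<open>The complements \<open>V - W\<close> play the role of containers. \<open>m\<close> is
  the number of vertices in a fingerprint, and the base \<open>card V + 1\<close> allows, for each
  of them, the choice of a vertex or an early stop.\<close>

definition avoiding_family :: "'a set \<Rightarrow> ('a set \<Rightarrow> real) \<Rightarrow> nat \<Rightarrow> real \<Rightarrow> bool" where
  "avoiding_family V h m a \<longleftrightarrow> (\<exists>\<W>. finite \<W> \<and> card \<W> \<le> (card V + 1) ^ m \<and>
     (\<forall>W\<in>\<W>. W \<subseteq> V \<and> a \<le> real (card W)) \<and>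
     (\<forall>I\<subseteq>V. (\<forall>E\<subseteq>I. h E = 0) \<longrightarrow> (\<exists>W\<in>\<W>. W \<inter> I = {})))"

text \<open>The hypergraph is \<open>j + 1\<close>-uniform, \<open>v\<close> stands for the size of the original vertex set, and
  \<open>b\<close> is the number of vertices that a fingerprint receives at each uniformity.\<close>

definition bounded_codegree :: "nat \<Rightarrow> nat \<Rightarrow> real \<Rightarrow> real \<Rightarrow> 'a set \<Rightarrow> ('a set \<Rightarrow> real) \<Rightarrow> bool" where
  "bounded_codegree j b v d V h \<longleftrightarrow>
     finite V \<and> real (card V) \<le> v \<and> 0 < v \<and> 0 < d \<and> 1 \<le> b \<and>
     (\<forall>E. 0 \<le> h E) \<and> (\<forall>E. h E \<noteq> 0 \<longrightarrow> card E = Suc j) \<and> (\<forall>x. wdeg V h {x} \<le> d) \<and>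
     (\<forall>x y. x \<noteq> y \<longrightarrow> wdeg V h {x, y} \<le> (real b / v) ^ j * d)"

text \<open>Pick vertices \<open>u\<close> of \<open>I\<close> one at a time and add their links to \<open>g\<close>, leaving out the edges that meet
  the set \<open>X\<close> of vertices whose degree in \<open>g\<close> is already at its target; \<open>X\<close> is too small to destroy
  many edges. Either at some point no vertex of high remaining degree is left in \<open>I\<close>, and these
  vertices form \<open>W\<close>, or after \<open>b\<close> steps \<open>g\<close> is a dense hypergraph of smaller uniformity in which \<open>I\<close> is
  independent. Summing over distinct \<open>u\<close> costs only a constant in the codegrees, so relative to the
  degrees they grow by a factor \<open>v / b\<close> per level.\<close>

lemma avoiding_family_Suc:
  fixes c \<alpha> d v :: real and j b :: nat and V :: "'a set" and h :: "'a set \<Rightarrow> real"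
  defines "J \<equiv> Suc (Suc j)"
  defines "K \<equiv> 4 * real J / c"
  assumes c: "0 < c" "c \<le> 1" and \<alpha>: "0 < \<alpha>" "\<alpha> \<le> c / (8 * K)"
    and q: "real b / v \<le> \<alpha>"
    and IH: "\<And>g. bounded_codegree j b v (2 * K * (real b / v) * d) V g \<Longrightarrow>
      c / (8 * K) * v * (2 * K * (real b / v) * d) \<le> wdeg V g {} \<Longrightarrow>
      avoiding_family V g (b * j) (\<alpha> * v)"
    and h: "bounded_codegree (Suc j) b v d V h" and tot: "c * v * d \<le> wdeg V h {}"
  shows "avoiding_family V h (b * Suc j) (\<alpha> * v)"
proof -
  have fin: "finite V" and cv: "real (card V) \<le> v" and v: "0 < v" and b: "1 \<le> b"
    and h0: "\<And>E. 0 \<le> h E" and hJ: "\<And>E. h E \<noteq> 0 \<Longrightarrow> card E = J"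
    and d: "0 < d" and hd: "\<And>x. wdeg V h {x} \<le> d"
    and hco: "\<And>x y. x \<noteq> y \<Longrightarrow> wdeg V h {x, y} \<le> (real b / v) ^ (Suc j) * d"
    using h unfolding bounded_codegree_def J_def by auto
  define q where "q = real b / v"
  \<comment> \<open>Target degree for the new hypergraph \<open>g\<close>. The total weight of
    \<open>g\<close> stays below \<open>b * d\<close>, so its degree sum is at most
    \<open>J * b * d = c * v / 4 * D\<close>; hence the set \<open>X\<close> of vertices beyond
    \<open>D\<close> fits the quota \<open>c * v / 4\<close> of
    \<open>many_high_degree\<close>.\<close>
  define D where "D = K * q * d"
  have q0: "0 < q" using b v by (simp add: q_def)
  have JK4: "4 * real J \<le> K"
    using c frac_le[of "4 * real J" "4 * real J" c 1] by (simp add: K_def)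
  hence K8: "8 \<le> K" and JK: "real J \<le> 2 * K" and K0: "0 < K"
    by (auto simp: J_def)
  have "c / (8 * K) \<le> c / 4" using c K8 by (intro divide_left_mono) auto
  hence \<alpha>c: "\<alpha> \<le> c / 4" using \<alpha> by simp
  hence qc: "q \<le> c / 4" using q unfolding q_def by linarith
  hence q1: "q \<le> 1" using c by simp
  have D0: "0 < D" using K0 q0 d by (simp add: D_def)
  have qdD: "q * d \<le> D"
    using K8 q0 d mult_right_mono[of 1 K "q * d"] by (simp add: D_def mult_ac)
  have bv: "real b \<le> c * v / 4" using qc v by (simp add: q_def field_simps)
  have codeg: "wdeg V h {x, y} \<le> q * d" if "x \<noteq> y" for x y
  proof -
    have "q ^ Suc j \<le> q ^ 1" using q0 q1 by (intro power_decreasing) auto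
    hence "q ^ Suc j * d \<le> q * d" using d by (intro mult_right_mono) auto
    with hco[OF that] show ?thesis by (simp add: q_def)
  qed
  \<comment> \<open>Induction on the number \<open>m\<close> of vertices still to be picked;
    \<open>U\<close> holds those already picked. Domination of \<open>g\<close> by the full links
    transfers independence and codegree bounds from \<open>h\<close>, the lower bound on the weight
    makes \<open>g\<close> dense at the end, and a degree may overshoot \<open>D\<close> by one
    codegree \<open>q * d\<close>.\<close>
  have inner: "\<exists>\<W>. finite \<W> \<and> card \<W> \<le> (card V + 1) ^ (m + b * j) \<and>
          (\<forall>W\<in>\<W>. W \<subseteq> V \<and> \<alpha> * v \<le> real (card W)) \<and>
          (\<forall>I\<subseteq>V. U \<subseteq> I \<longrightarrow> (\<forall>E\<subseteq>I. h E = 0) \<longrightarrow> (\<exists>W\<in>\<W>. W \<inter> I = {}))"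
    if "U \<subseteq> V" "card U + m = b" "\<And>E. 0 \<le> g E" "\<And>E. g E \<noteq> 0 \<Longrightarrow> card E = Suc j"
      "\<And>B. g B \<le> (\<Sum>u\<in>U. link h u B)" "real (card U) * (c / 4 * d) \<le> wdeg V g {}"
      "\<And>x. wdeg V g {x} \<le> D + q * d" for m U g
    using that
  proof (induction m arbitrary: U g)
    case 0
    note U = \<open>U \<subseteq> V\<close>
    have "wdeg V g {x} \<le> 2 * K * (real b / v) * d" for x
    proof -
      have e: "2 * K * (real b / v) * d = D + D" by (simp add: D_def q_def)
      show ?thesis unfolding e using "0.prems"(7)[of x] qdD by linarith
    qed
    moreover have "wdeg V g {x, y} \<le> (real b / v) ^ j * (2 * K * (real b / v) * d)" if "x \<noteq> y" for x y
    proof (cases "{x, y} \<subseteq> V")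
      case True
      have "wdeg V g {x, y} \<le> (\<Sum>u\<in>U. wdeg V (link h u) {x, y})"
        using wdeg_le_wdeg[of g "\<lambda>B. \<Sum>u\<in>U. link h u B" V "{x, y}"] "0.prems"(5)
        by (simp add: wdeg_sum)
      also have "\<dots> = (\<Sum>u\<in>U. if u \<in> {x, y} then 0 else wdeg V h (insert u {x, y}))"
        using U fin by (intro sum.cong refl wdeg_link) auto
      also have "\<dots> \<le> (\<Sum>u\<in>V. if u \<in> {x, y} then 0 else wdeg V h (insert u {x, y}))"
        using U fin h0 by (intro sum_mono2) (auto intro: wdeg_nonneg)
      also have "\<dots> = (\<Sum>u\<in>V - {x, y}. wdeg V h (insert u {x, y}))"
        using fin by (intro sum.mono_neutral_cong_right) auto
      also have "\<dots> = real (J - card {x, y}) * wdeg V h {x, y}"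
        by (rule sum_wdeg_insert) (use fin True hJ in auto)
      \<comment> \<open>The factor \<open>J - 2\<close> from double counting is at most
        \<open>2 * K\<close>, and one factor \<open>q\<close> of \<open>q ^ Suc j * d\<close> moves
        into the new degree bound \<open>2 * K * q * d\<close>.\<close>
      also have "\<dots> \<le> (2 * K) * (q ^ Suc j * d)"
        using hco[OF that] JK K0 h0 by (intro mult_mono) (auto simp: q_def wdeg_nonneg)
      finally show ?thesis by (simp add: q_def mult_ac)
    next
      case False
      then show ?thesis using wdeg_outside[OF False, of g] K0 d v by simp
    qed
    \<comment> \<open>Origin of the new density: \<open>b\<close> links of weight at least
      \<open>c / 4 * d\<close> each, divided by \<open>v\<close> times the new degree bound
      \<open>2 * K * (b / v) * d\<close>.\<close>
    moreover have "c / (8 * K) * v * (2 * K * (real b / v) * d) \<le> wdeg V g {}"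
      using "0.prems"(6) "0.prems"(2) K0 v by (simp add: field_simps)
    ultimately obtain \<W> where W: "finite \<W>" "card \<W> \<le> (card V + 1) ^ (b * j)"
        "\<forall>W\<in>\<W>. W \<subseteq> V \<and> \<alpha> * v \<le> real (card W)"
        "\<And>I. I \<subseteq> V \<Longrightarrow> (\<forall>E\<subseteq>I. g E = 0) \<Longrightarrow> (\<exists>W\<in>\<W>. W \<inter> I = {})"
      using IH[of g] "0.prems"(3,4) K0 v d fin cv b
      unfolding bounded_codegree_def avoiding_family_def by auto
    have "\<exists>W\<in>\<W>. W \<inter> I = {}" if I: "I \<subseteq> V" "U \<subseteq> I" "\<forall>E\<subseteq>I. h E = 0" for I
    proof (rule W(4)[OF I(1)], safe)
      fix B assume "B \<subseteq> I"
      hence "(\<Sum>u\<in>U. link h u B) = 0" using I by (intro sum.neutral) (auto simp: link_def)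
      thus "g B = 0" using "0.prems"(5)[of B] "0.prems"(3)[of B] by simp
    qed
    thus ?case using W by (intro exI[of _ \<W>]) auto
  next
    case (Suc m)
    note U = \<open>U \<subseteq> V\<close>
    define X where "X = {x \<in> V. D < wdeg V g {x}}"
    define h' where "h' = (\<lambda>E. if E \<inter> X = {} then h E else 0)"
    define H where "H = {u \<in> V - U. c / 4 * d \<le> wdeg V h' {u}}"
    have finU: "finite U" using U fin finite_subset by auto
    have "real (card X) * D \<le> (\<Sum>x\<in>X. wdeg V g {x})"
      by (rule sum_bounded_below) (auto simp: X_def)
    also have "\<dots> \<le> (\<Sum>x\<in>V. wdeg V g {x})"
      using fin Suc.prems(3) by (intro sum_mono2) (auto simp: X_def intro: wdeg_nonneg)
    also have "\<dots> = real (Suc j) * wdeg V g {}"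
      by (rule sum_wdeg_singleton) (use fin Suc.prems in auto)
    also have "\<dots> \<le> real J * (real b * d)"
    proof (intro mult_mono)
      have "wdeg V g {} \<le> (\<Sum>u\<in>U. wdeg V (link h u) {})"
        using wdeg_le_wdeg[of g "\<lambda>B. \<Sum>u\<in>U. link h u B" V "{}"] Suc.prems(5)
        by (simp add: wdeg_sum)
      also have "\<dots> = (\<Sum>u\<in>U. wdeg V h {u})"
        using U fin by (intro sum.cong refl) (subst wdeg_link, auto)
      also have "\<dots> \<le> real (card U) * d" using hd by (intro sum_bounded_above) auto
      also have "\<dots> \<le> real b * d" using Suc.prems(2) d by (intro mult_right_mono) auto
      finally show "wdeg V g {} \<le> real b * d" .
    qed (use Suc.prems(3) in \<open>auto simp: J_def intro: wdeg_nonneg\<close>)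
    also have "\<dots> = c * v / 4 * D"
      using v c by (simp add: D_def q_def K_def)
    finally have cX: "real (card X) \<le> c * v / 4" using D0 by simp
    have cU: "real (card U) \<le> c * v / 4" using bv Suc.prems(2) by simp
    have "c * v / 4 \<le> real (card H)"
      unfolding H_def h'_def
      by (rule many_high_degree[of V v h J d c X U])
        (use fin cv h0 hJ d c hd tot cX cU U in \<open>auto simp: J_def X_def\<close>)
    moreover have "\<alpha> * v \<le> c / 4 * v" using \<alpha>c v by (intro mult_right_mono) auto
    ultimately have bigH: "\<alpha> * v \<le> real (card H)" by simp
    have "\<exists>\<W>. finite \<W> \<and> card \<W> \<le> (card V + 1) ^ (m + b * j) \<and>
          (\<forall>W\<in>\<W>. W \<subseteq> V \<and> \<alpha> * v \<le> real (card W)) \<and>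
          (\<forall>I\<subseteq>V. insert u U \<subseteq> I \<longrightarrow> (\<forall>E\<subseteq>I. h E = 0) \<longrightarrow> (\<exists>W\<in>\<W>. W \<inter> I = {}))" if u: "u \<in> H" for u
    proof (rule Suc.IH[of "insert u U" "\<lambda>B. g B + link h' u B"])
      have uV: "u \<in> V" "u \<notin> U" and udeg: "c / 4 * d \<le> wdeg V h' {u}" using u by (auto simp: H_def)
      show "insert u U \<subseteq> V" using uV U by auto
      show "card (insert u U) + m = b" using uV finU Suc.prems(2) by simp
      show "0 \<le> g E + link h' u E" for E using Suc.prems(3) h0 by (auto simp: link_def h'_def)
      show "card E = Suc j" if "g E + link h' u E \<noteq> 0" for E
      proof (cases "g E = 0")
        case True
        hence "u \<notin> E" "h (insert u E) \<noteq> 0" using that by (auto simp: link_def h'_def split: if_splits)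
        hence "card (insert u E) = Suc (Suc j)" "u \<notin> E" using hJ by (auto simp: J_def)
        thus ?thesis by (metis Zero_not_Suc card.infinite card_insert_disjoint finite_insert nat.inject)
      qed (use Suc.prems(4) in auto)
      show "g B + link h' u B \<le> (\<Sum>u\<in>insert u U. link h u B)" for B
        using Suc.prems(5)[of B] uV finU h0 by (auto simp: link_def h'_def add_increasing)
      show "real (card (insert u U)) * (c / 4 * d) \<le> wdeg V (\<lambda>B. g B + link h' u B) {}"
        using Suc.prems(6) udeg uV finU by (simp add: wdeg_add wdeg_link fin algebra_simps)
      \<comment> \<open>Vertices of \<open>X\<close> gain nothing, since \<open>h'\<close> has no
        edge through them; any other vertex has degree at most \<open>D\<close> in \<open>g\<close>
        and gains at most \<open>q * d\<close>.\<close>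
      show "wdeg V (\<lambda>B. g B + link h' u B) {x} \<le> D + q * d" for x
      proof -
        have *: "wdeg V (\<lambda>B. g B + link h' u B) {x} = wdeg V g {x} + (if u = x then 0 else wdeg V h' {u, x})"
          using uV fin by (simp add: wdeg_add wdeg_link)
        show ?thesis
        proof (cases "x \<in> X")
          case True
          have "wdeg V h' {u, x} = 0" unfolding wdeg_def
            by (rule sum.neutral) (use True in \<open>auto simp: h'_def\<close>)
          thus ?thesis using * Suc.prems(7)[of x] by simp
        next
          case False
          have "wdeg V g {x} \<le> D"
          proof (cases "x \<in> V")
            case True thus ?thesis using False by (auto simp: X_def)
          next
            case False thus ?thesis using wdeg_outside[of "{x}" V g] D0 by simp
          qed
          moreover have "wdeg V h' {u, x} \<le> q * d" if "u \<noteq> x"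
            using codeg[OF that] wdeg_le_wdeg[of h' h V "{u, x}"] h0 by (fastforce simp: h'_def)
          ultimately show ?thesis using * q0 d by (auto simp: add_mono add_increasing2)
        qed
      qed
    qed
    then obtain f where f: "\<And>u. u \<in> H \<Longrightarrow> finite (f u)"
        "\<And>u. u \<in> H \<Longrightarrow> card (f u) \<le> (card V + 1) ^ (m + b * j)"
        "\<And>u W. u \<in> H \<Longrightarrow> W \<in> f u \<Longrightarrow> W \<subseteq> V \<and> \<alpha> * v \<le> real (card W)"
        "\<And>u I. u \<in> H \<Longrightarrow> I \<subseteq> V \<Longrightarrow> insert u U \<subseteq> I \<Longrightarrow> \<forall>E\<subseteq>I. h E = 0 \<Longrightarrow> \<exists>W\<in>f u. W \<inter> I = {}"
      by metis
    have finH: "finite H" "H \<subseteq> V" using fin by (auto simp: H_def)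
    show ?case
    \<comment> \<open>Either the independent set misses \<open>H\<close>, which then serves as
      \<open>W\<close>, or it contains some \<open>u \<in> H\<close> and the family of that branch
      applies.\<close>
    proof (intro exI[of _ "insert H (\<Union>u\<in>H. f u)"] conjI ballI allI impI)
      show "finite (insert H (\<Union>u\<in>H. f u))" using finH f by auto
      show "card (insert H (\<Union>u\<in>H. f u)) \<le> (card V + 1) ^ (Suc m + b * j)"
        using card_insert_UN_le[of H f "(card V + 1) ^ (m + b * j)" "card V" H] f(2) finH fin
        by (simp add: card_mono)
      show "W \<subseteq> V" "\<alpha> * v \<le> real (card W)" if "W \<in> insert H (\<Union>u\<in>H. f u)" for W
        using that f(3) bigH finH by auto
      show "\<exists>W\<in>insert H (\<Union>u\<in>H. f u). W \<inter> I = {}"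
        if "I \<subseteq> V" "U \<subseteq> I" "\<forall>E\<subseteq>I. h E = 0" for I
      proof (cases "H \<inter> I = {}")
        case False
        then obtain u where "u \<in> H" "u \<in> I" by auto
        with f(4)[of u I] that show ?thesis by blast
      qed auto
    qed
  qed
  have "\<exists>\<W>. finite \<W> \<and> card \<W> \<le> (card V + 1) ^ (b + b * j) \<and>
          (\<forall>W\<in>\<W>. W \<subseteq> V \<and> \<alpha> * v \<le> real (card W)) \<and>
          (\<forall>I\<subseteq>V. {} \<subseteq> I \<longrightarrow> (\<forall>E\<subseteq>I. h E = 0) \<longrightarrow> (\<exists>W\<in>\<W>. W \<inter> I = {}))"
    by (rule inner[of "{}" b "\<lambda>_. 0"]) (use D0 q0 d in \<open>auto simp: wdeg_def add_nonneg_nonneg\<close>)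
  thus ?thesis unfolding avoiding_family_def by simp
qed

text \<open>The density drops by the factor \<open>8 * K\<close> with each level, so
  \<open>\<alpha>\<close> depends on \<open>c\<close> and \<open>j\<close> alone. The conjunct
  \<open>\<alpha> \<le> c\<close> carries the induction: the \<open>\<alpha>\<close> of the lower
  uniformity is then at most \<open>c / (8 * K)\<close>, hence at most \<open>c / 4\<close>, and the
  sets \<open>H\<close> are large enough.\<close>

lemma avoiding_family_exists:
  assumes "0 < c" "c \<le> 1"
  shows "\<exists>\<alpha>>0. \<alpha> \<le> c \<and> (\<forall>(V::'a set) h d b v. bounded_codegree j b v d V h \<longrightarrow> c * v * d \<le> wdeg V h {} \<longrightarrow>
    real b / v \<le> \<alpha> \<longrightarrow> avoiding_family V h (b * j) (\<alpha> * v))"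
  using assms
proof (induction j arbitrary: c)
  case 0
  show ?case
  proof (intro exI[of _ c] conjI allI impI)
    fix V :: "'a set" and h d b and v :: real
    assume a: "bounded_codegree 0 b v d V h" "c * v * d \<le> wdeg V h {}"
    obtain W where "W \<subseteq> V" "c * v \<le> real (card W)" "\<forall>I\<subseteq>V. (\<forall>E\<subseteq>I. h E = 0) \<longrightarrow> W \<inter> I = {}"
      using avoiding_set_uniform_1[of c V v h d] a 0 by (auto simp: bounded_codegree_def)
    thus "avoiding_family V h (b * 0) (c * v)"
      unfolding avoiding_family_def by (intro exI[of _ "{W}"]) auto
  qed (use 0 in auto)
next
  case (Suc j)
  define K where "K = 4 * real (Suc (Suc j)) / c"
  have "4 * real (Suc (Suc j)) \<le> K"
    using Suc.prems frac_le[of "4 * real (Suc (Suc j))" "4 * real (Suc (Suc j))" c 1] by (simp add: K_def)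
  hence K: "8 \<le> K" by simp
  have "c / (8 * K) \<le> c / 1" using Suc.prems K by (intro divide_left_mono) auto
  hence c': "0 < c / (8 * K)" "c / (8 * K) \<le> c" "c / (8 * K) \<le> 1"
    using Suc.prems K by auto
  obtain \<alpha> where \<alpha>: "0 < \<alpha>" "\<alpha> \<le> c / (8 * K)" and IH: "\<And>(V::'a set) h d b v. bounded_codegree j b v d V h \<Longrightarrow> c / (8 * K) * v * d \<le> wdeg V h {} \<Longrightarrow>
    real b / v \<le> \<alpha> \<Longrightarrow> avoiding_family V h (b * j) (\<alpha> * v)"
    using Suc.IH[OF c'(1,3)] by blast
  show ?case
  proof (intro exI[of _ \<alpha>] conjI allI impI)
    fix V :: "'a set" and h d b and v :: real
    assume a: "bounded_codegree (Suc j) b v d V h" "c * v * d \<le> wdeg V h {}" "real b / v \<le> \<alpha>"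
    show "avoiding_family V h (b * Suc j) (\<alpha> * v)"
      by (rule avoiding_family_Suc[OF Suc.prems \<alpha>[unfolded K_def] a(3) _ a(1,2)],
          rule IH[unfolded K_def], assumption, assumption, rule a(3))
  qed (use \<alpha> c' in auto)
qed

text \<open>While the current vertex set has weight at least \<open>c * v * d\<close>, some
  \<open>\<alpha> * v\<close> vertices outside the independent set can be removed. The degree bounds
  pass to subsets with the same \<open>v\<close> and \<open>d\<close>, so at most \<open>L\<close>,
  about \<open>1 / \<alpha>\<close>, removals occur.\<close>

lemma containers:
  fixes c :: real
  assumes "0 < c" "c \<le> 1"
  shows "\<exists>\<alpha>>0. \<exists>L. \<forall>(V::'a set) h d b v. bounded_codegree j b v d V h \<longrightarrow> real b / v \<le> \<alpha> \<longrightarrow>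
    (\<exists>\<C>. finite \<C> \<and> card \<C> \<le> (card V + 1) ^ (b * j * L) \<and>
        (\<forall>C\<in>\<C>. C \<subseteq> V \<and> wdeg C h {} < c * v * d) \<and>
        (\<forall>I\<subseteq>V. (\<forall>E\<subseteq>I. h E = 0) \<longrightarrow> (\<exists>C\<in>\<C>. I \<subseteq> C)))"
proof -
  obtain \<alpha> where \<alpha>: "0 < \<alpha>" and step: "\<And>(V::'a set) h d b v. bounded_codegree j b v d V h \<Longrightarrow> c * v * d \<le> wdeg V h {} \<Longrightarrow>
    real b / v \<le> \<alpha> \<Longrightarrow> avoiding_family V h (b * j) (\<alpha> * v)"
    using avoiding_family_exists[OF assms, where ?'a = 'a and j = j] by blast
  define L where "L = nat \<lceil>1 / \<alpha>\<rceil>"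
  have "1 / \<alpha> \<le> real L" unfolding L_def by (rule real_nat_ceiling_ge)
  hence L: "1 \<le> real L * \<alpha>" using \<alpha> by (simp add: pos_divide_le_eq)
  show ?thesis
  proof (intro exI[of _ \<alpha>] exI[of _ L] conjI allI impI)
    fix V :: "'a set" and h d b and v :: real
    assume h: "bounded_codegree j b v d V h" and bv: "real b / v \<le> \<alpha>"
    hence a: "finite V" "real (card V) \<le> v" "0 < v" "\<forall>E. 0 \<le> h E"
      "\<forall>E. h E \<noteq> 0 \<longrightarrow> card E = Suc j" "0 < d"
      by (auto simp: bounded_codegree_def)
    define M where "M = (card V + 1) ^ (b * j)"
    \<comment> \<open>\<open>m\<close> bounds the number of removals still possible; each costs a
      factor \<open>M\<close>.\<close>
    have "\<exists>\<C>. finite \<C> \<and> card \<C> \<le> M ^ m \<and>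
        (\<forall>C\<in>\<C>. C \<subseteq> V' \<and> wdeg C h {} < c * v * d) \<and>
        (\<forall>I\<subseteq>V'. (\<forall>E\<subseteq>I. h E = 0) \<longrightarrow> (\<exists>C\<in>\<C>. I \<subseteq> C))"
      if "V' \<subseteq> V" "real (card V') \<le> real m * (\<alpha> * v)" for V' m
      using that
    proof (induction m arbitrary: V')
      case 0
      hence "V' = {}" using a(1) finite_subset by fastforce
      moreover have "wdeg {} h {} = 0" using a(5) by (auto simp: wdeg_def)
      ultimately show ?case using assms a by (intro exI[of _ "{{}}"]) auto
    next
      case (Suc m)
      have fin: "finite V'" using Suc.prems a(1) finite_subset by auto
      show ?case
      proof (cases "wdeg V' h {} < c * v * d")
        case True
        have "M \<ge> 1" by (simp add: M_def)
        hence "1 \<le> M ^ Suc m" by (rule one_le_power)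
        then show ?thesis using True by (intro exI[of _ "{V'}"]) auto
      next
        case False
        have le: "wdeg V' h F \<le> wdeg V h F" for F
          using a Suc.prems by (intro wdeg_mono) auto
        have "real (card V') \<le> v" using card_mono[OF a(1) Suc.prems(1)] a(2) by simp
        hence h': "bounded_codegree j b v d V' h"
          using h fin le order_trans[OF le] unfolding bounded_codegree_def by auto
        obtain \<W> where W: "finite \<W>" "card \<W> \<le> (card V' + 1) ^ (b * j)"
          "\<And>W. W \<in> \<W> \<Longrightarrow> W \<subseteq> V' \<and> \<alpha> * v \<le> real (card W)"
          "\<And>I. I \<subseteq> V' \<Longrightarrow> \<forall>E\<subseteq>I. h E = 0 \<Longrightarrow> \<exists>W\<in>\<W>. W \<inter> I = {}"
          using step[of b v d V' h] h' bv False unfolding avoiding_family_def by (auto simp: not_less)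
        have cW: "card \<W> \<le> M"
          using W(2) card_mono[OF a(1) Suc.prems(1)] unfolding M_def
          by (meson add_le_mono1 order_trans power_mono zero_le)
        have "\<exists>\<C>. finite \<C> \<and> card \<C> \<le> M ^ m \<and>
          (\<forall>C\<in>\<C>. C \<subseteq> V' - W \<and> wdeg C h {} < c * v * d) \<and>
          (\<forall>I\<subseteq>V' - W. (\<forall>E\<subseteq>I. h E = 0) \<longrightarrow> (\<exists>C\<in>\<C>. I \<subseteq> C))" if "W \<in> \<W>" for W
        proof (rule Suc.IH)
          show "V' - W \<subseteq> V" using Suc.prems by auto
          have "card (V' - W) + card W = card V'"
            using W(3)[OF that] fin by (metis card_Diff_subset card_mono finite_subset le_add_diff_inverse2)
          hence "real (card (V' - W)) + real (card W) = real (card V')" by linarith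
          thus "real (card (V' - W)) \<le> real m * (\<alpha> * v)"
            using W(3)[OF that] Suc.prems(2) by (simp add: algebra_simps)
        qed
        then obtain f where f: "\<And>W. W \<in> \<W> \<Longrightarrow> finite (f W)" "\<And>W. W \<in> \<W> \<Longrightarrow> card (f W) \<le> M ^ m"
          "\<And>W C. W \<in> \<W> \<Longrightarrow> C \<in> f W \<Longrightarrow> C \<subseteq> V' - W \<and> wdeg C h {} < c * v * d"
          "\<And>W I. W \<in> \<W> \<Longrightarrow> I \<subseteq> V' - W \<Longrightarrow> \<forall>E\<subseteq>I. h E = 0 \<Longrightarrow> \<exists>C\<in>f W. I \<subseteq> C"
          by metis
        show ?thesis
        proof (intro exI[of _ "\<Union>W\<in>\<W>. f W"] conjI ballI allI impI)
          show "finite (\<Union>W\<in>\<W>. f W)" using W f by auto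
          have "card (\<Union>W\<in>\<W>. f W) \<le> (\<Sum>W\<in>\<W>. card (f W))" by (rule card_UN_le[OF W(1)])
          also have "\<dots> \<le> card \<W> * M ^ m" using sum_bounded_above[of \<W> "\<lambda>W. card (f W)" "M ^ m"] f by simp
          also have "\<dots> \<le> M ^ Suc m" using cW by simp
          finally show "card (\<Union>W\<in>\<W>. f W) \<le> M ^ Suc m" .
          show "C \<subseteq> V'" "wdeg C h {} < c * v * d" if "C \<in> (\<Union>W\<in>\<W>. f W)" for C using that f(3) by auto
          show "\<exists>C\<in>\<Union>W\<in>\<W>. f W. I \<subseteq> C" if I: "I \<subseteq> V'" "\<forall>E\<subseteq>I. h E = 0" for I
          proof -
            obtain W where "W \<in> \<W>" "W \<inter> I = {}" using W(4)[OF I] by auto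
            with f(4)[of W I] I show ?thesis by blast
          qed
        qed
      qed
    qed
    moreover have "v \<le> real L * (\<alpha> * v)"
      using L a(3) by (simp add: mult.assoc[symmetric])
    hence "real (card V) \<le> real L * (\<alpha> * v)" using a(2) by (rule order_trans[rotated])
    ultimately show "\<exists>\<C>. finite \<C> \<and> card \<C> \<le> (card V + 1) ^ (b * j * L) \<and>
        (\<forall>C\<in>\<C>. C \<subseteq> V \<and> wdeg C h {} < c * v * d) \<and>
        (\<forall>I\<subseteq>V. (\<forall>E\<subseteq>I. h E = 0) \<longrightarrow> (\<exists>C\<in>\<C>. I \<subseteq> C))"
      by (auto simp: M_def power_mult)
  qed (use \<alpha> in auto)
qed

section \<open>Restrictions of colourings and templates\<close>

definition edges_on :: "nat set \<Rightarrow> nat set set" where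
  "edges_on A = {e. e \<subseteq> A \<and> card e = 2}"

lemma edges_eq_edges_on: "edges n = edges_on {1..n}"
  by (simp add: edges_def edges_on_def)

lemma finite_edges_on: "finite A \<Longrightarrow> finite (edges_on A)"
  by (simp add: edges_on_def)

lemma card_edges_on: "finite A \<Longrightarrow> card (edges_on A) = card A choose 2"
  by (simp add: edges_on_def n_subsets)

lemma finite_edges [simp]: "finite (edges n)"
  by (simp add: edges_eq_edges_on finite_edges_on)

lemma card_edges: "card (edges n) = n choose 2"
  by (simp add: edges_eq_edges_on card_edges_on)

lemma edges_on_subset_edges: "A \<subseteq> {1..n} \<Longrightarrow> edges_on A \<subseteq> edges n"
  by (auto simp: edges_on_def edges_def)

text \<open>Lets the vertex set of a forbidden copy be read off its edges, so that copies on
  different sets are different.\<close>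

lemma Union_edges_on:
  assumes "finite A" "2 \<le> card A"
  shows "\<Union>(edges_on A) = A"
proof
  show "A \<subseteq> \<Union>(edges_on A)"
  proof
    fix a assume a: "a \<in> A"
    have "A \<noteq> {a}" using assms by auto
    then obtain b where "b \<in> A" "b \<noteq> a" using a by auto
    hence "{a, b} \<in> edges_on A" using a by (auto simp: edges_on_def)
    thus "a \<in> \<Union>(edges_on A)" by auto
  qed
qed (auto simp: edges_on_def)

lemma nth_elem_image_sorted:
  assumes "finite A" "strict_mono_on A f" "j \<in> {1..card A}"
  shows "nth_elem (f ` A) j = f (nth_elem A j)"
proof -
  have "sorted_list_of_set (f ` A) = map f (sorted_list_of_set A)"
  proof (rule sorted_distinct_set_unique)
    show "sorted (map f (sorted_list_of_set A))"
      unfolding sorted_map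
      by (rule sorted_wrt_mono_rel[of _ "(\<le>)"])
        (use assms in \<open>auto dest: strict_mono_on_leD\<close>)
    show "distinct (map f (sorted_list_of_set A))"
      using assms strict_mono_on_imp_inj_on by (auto simp: distinct_map)
  qed (use assms in auto)
  moreover have "j - 1 < length (sorted_list_of_set A)" using assms by auto
  ultimately show ?thesis unfolding nth_elem_def by (simp only: nth_map)
qed

lemma bij_betw_nth_elem:
  assumes "finite A"
  shows "bij_betw (nth_elem A) {1..card A} A"
proof -
  have "bij_betw (\<lambda>j. j - 1) {1..card A} {..<card A}"
    by (rule bij_betw_byWitness[where f' = Suc]) auto
  moreover have "bij_betw ((!) (sorted_list_of_set A)) {..<card A} A"
    by (rule bij_betw_nth) (use assms in auto)
  ultimately have "bij_betw ((!) (sorted_list_of_set A) \<circ> (\<lambda>j. j - 1)) {1..card A} A"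
    by (rule bij_betw_trans)
  thus ?thesis by (simp add: nth_elem_def[abs_def] comp_def)
qed

lemma strict_mono_on_nth_elem:
  assumes "finite A"
  shows "strict_mono_on {1..card A} (nth_elem A)"
proof (rule strict_mono_onI)
  fix x y assume "x \<in> {1..card A}" "y \<in> {1..card A}" "x < y"
  thus "nth_elem A x < nth_elem A y"
    using sorted_wrt_nth_less[OF strict_sorted_list_of_set[of A], of "x - 1" "y - 1"]
    by (simp add: nth_elem_def)
qed

lemma bij_betw_image_edges_on:
  assumes "bij_betw f A B"
  shows "bij_betw (\<lambda>e. f ` e) (edges_on A) (edges_on B)"
proof -
  have f: "inj_on f A" "f ` A = B" using assms by (auto simp: bij_betw_def)
  show ?thesis
  proof (rule bij_betw_imageI)
    show "inj_on (\<lambda>e. f ` e) (edges_on A)"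
      using f(1) by (intro inj_onI) (auto simp: edges_on_def inj_on_image_eq_iff)
    show "(\<lambda>e. f ` e) ` edges_on A = edges_on B"
    proof
      show "(\<lambda>e. f ` e) ` edges_on A \<subseteq> edges_on B"
        using f by (auto simp: edges_on_def card_image inj_on_subset)
      show "edges_on B \<subseteq> (\<lambda>e. f ` e) ` edges_on A"
      proof
        fix e assume e: "e \<in> edges_on B"
        then obtain e' where e': "e' \<subseteq> A" "e = f ` e'"
          using f(2) by (auto simp: edges_on_def subset_image_iff)
        moreover have "card e' = 2"
          using card_image[OF inj_on_subset[OF f(1) e'(1)]] e e'(2) by (simp add: edges_on_def)
        ultimately show "e \<in> (\<lambda>e. f ` e) ` edges_on A" by (auto simp: edges_on_def)
      qed
    qed
  qed
qed

lemma bij_betw_edges_nth_elem: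
  assumes "finite A"
  shows "bij_betw (\<lambda>e. nth_elem A ` e) (edges (card A)) (edges_on A)"
  unfolding edges_eq_edges_on by (rule bij_betw_image_edges_on[OF bij_betw_nth_elem[OF assms]])

lemma nth_elem_image_in:
  assumes "finite A" "e \<in> edges (card A)"
  shows "nth_elem A ` e \<in> edges_on A"
  using bij_betw_edges_nth_elem[OF assms(1)] assms(2) by (auto simp: bij_betw_def)

lemma nth_elem_subset:
  assumes "finite M" "B \<subseteq> {1..card M}"
  shows "nth_elem M ` B \<subseteq> M" "card (nth_elem M ` B) = card B"
  using bij_betw_nth_elem[OF assms(1)] assms(2)
  by (auto simp: bij_betw_def card_image inj_on_subset)

lemma col_restrict_cong:
  assumes "finite A" "\<And>e. e \<in> edges_on A \<Longrightarrow> c e = c' e"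
  shows "col_restrict c A = col_restrict c' A"
  unfolding col_restrict_def using assms nth_elem_image_in by (intro restrict_ext) auto

lemma col_restrict_in_colourings:
  assumes "c \<in> colourings k n" "A \<subseteq> {1..n}"
  shows "col_restrict c A \<in> colourings k (card A)"
proof -
  have "finite A" using assms(2) finite_subset by auto
  thus ?thesis
    using assms nth_elem_image_in[of A] edges_on_subset_edges[OF assms(2)]
    unfolding col_restrict_def colourings_def by (auto simp: PiE_iff)
qed

text \<open>The enumeration of \<open>M\<close> is increasing, so composed with that of
  \<open>B\<close> it is the enumeration of the image of \<open>B\<close>. Hence restriction is
  transitive although it renames vertices.\<close>

lemma col_restrict_col_restrict:
  assumes M: "finite M" and B: "B \<subseteq> {1..card M}"
  shows "col_restrict (col_restrict c M) B = col_restrict c (nth_elem M ` B)"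
proof -
  have finB: "finite B" using B finite_subset by auto
  have "col_restrict c M (nth_elem B ` e) = c (nth_elem (nth_elem M ` B) ` e)"
    if e: "e \<in> edges (card B)" for e
  proof -
    have "nth_elem B ` e \<in> edges_on B" by (rule nth_elem_image_in[OF finB e])
    hence "nth_elem B ` e \<in> edges (card M)" using edges_on_subset_edges[OF B] by auto
    hence "col_restrict c M (nth_elem B ` e) = c (nth_elem M ` nth_elem B ` e)"
      by (simp add: col_restrict_def)
    also have "nth_elem M ` nth_elem B ` e = nth_elem (nth_elem M ` B) ` e"
      unfolding image_image
    proof (rule image_cong[OF refl])
      fix x assume "x \<in> e"
      hence "x \<in> {1..card B}" using e by (auto simp: edges_def)
      thus "nth_elem M (nth_elem B x) = nth_elem (nth_elem M ` B) x"
        using nth_elem_image_sorted[of B "nth_elem M" x] finB B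
          monotone_on_subset[OF strict_mono_on_nth_elem[OF M] B] by simp
    qed
    finally show ?thesis .
  qed
  thus ?thesis
    unfolding col_restrict_def[of _ B] col_restrict_def[of _ "nth_elem M ` B"]
    using nth_elem_subset(2)[OF M B] by (intro ext) (auto simp: restrict_def)
qed

text \<open>A forbidden pattern on fewer than \<open>N\<close> vertices is detected on any
  \<open>N\<close>-set around it, which \<open>N \<le> n\<close> provides; the other direction is
  heredity. Testing \<open>N\<close>-sets makes the hypergraph of copies uniform.\<close>

lemma mem_property_iff:
  assumes her: "order_hereditary k P" and forb: "defined_by_forbidden k N P"
    and n: "N \<le> n" and c: "c \<in> colourings k n"
  shows "c \<in> P n \<longleftrightarrow> (\<forall>A\<subseteq>{1..n}. card A = N \<longrightarrow> col_restrict c A \<in> P N)"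
proof
  assume "c \<in> P n"
  thus "\<forall>A\<subseteq>{1..n}. card A = N \<longrightarrow> col_restrict c A \<in> P N"
    using her unfolding order_hereditary_def by blast
next
  assume R: "\<forall>A\<subseteq>{1..n}. card A = N \<longrightarrow> col_restrict c A \<in> P N"
  obtain F where F': "(\<forall>m. F m \<subseteq> colourings k m) \<and> (\<forall>m>N. F m = {}) \<and>
      (\<forall>n. \<forall>c\<in>colourings k n. c \<in> P n \<longleftrightarrow> (\<forall>A\<subseteq>{1..n}. col_restrict c A \<notin> F (card A)))"
    using forb unfolding defined_by_forbidden_def by (rule exE)
  hence F: "\<forall>m>N. F m = {}"
    "\<forall>n. \<forall>c\<in>colourings k n. c \<in> P n \<longleftrightarrow> (\<forall>A\<subseteq>{1..n}. col_restrict c A \<notin> F (card A))"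
    by (iprover+)
  show "c \<in> P n"
    unfolding F(2)[rule_format, OF c]
  proof (intro allI impI notI)
    fix B assume B: "B \<subseteq> {1..n}" "col_restrict c B \<in> F (card B)"
    have BN: "card B \<le> N" using F(1) B(2) by (cases "card B \<le> N") auto
    have finB: "finite B" using B(1) finite_subset by auto
    obtain A where A: "B \<subseteq> A" "A \<subseteq> {1..n}" "card A = N"
      using exists_subset_between[of B N "{1..n}"] BN n B(1) finB by auto
    have finA: "finite A" using A(2) finite_subset by auto
    obtain B' where B': "B' \<subseteq> {1..card A}" "B = nth_elem A ` B'"
      using A(1) bij_betw_imp_surj_on[OF bij_betw_nth_elem[OF finA]] by (metis subset_imageE)
    have *: "col_restrict (col_restrict c A) B' = col_restrict c B" "card B' = card B"
      using col_restrict_col_restrict[OF finA B'(1)] nth_elem_subset(2)[OF finA B'(1)] B'(2) by auto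
    have "col_restrict c A \<in> P N" "col_restrict c A \<in> colourings k N"
      using R A col_restrict_in_colourings[OF c A(2)] by auto
    hence "col_restrict (col_restrict c A) B' \<notin> F (card B')"
      using F(2)[rule_format, of "col_restrict c A" N] B'(1) A(3) by blast
    with B(2) * show False by simp
  qed
qed

definition sub_template :: "template \<Rightarrow> nat set \<Rightarrow> template" where
  "sub_template t M = (\<lambda>e\<in>edges (card M). t (nth_elem M ` e))"

text \<open>Edges outside \<open>M\<close> can be coloured freely from \<open>t\<close>, whose
  values are nonempty.\<close>

lemma realisations_lift:
  assumes t: "t \<in> templates k n" and M: "M \<subseteq> {1..n}"
    and c: "c \<in> realisations k (card M) (sub_template t M)"
  obtains c' where "c' \<in> realisations k n t" "col_restrict c' M = c"
proof -
  define inv where "inv = inv_into (edges (card M)) (\<lambda>e. nth_elem M ` e)"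
  define c' where "c' = (\<lambda>e. if e \<in> edges_on M then c (inv e)
      else if e \<in> edges n then (SOME x. x \<in> t e) else undefined)"
  have finM: "finite M" using M finite_subset by auto
  note bij = bij_betw_edges_nth_elem[OF finM]
  note sub = edges_on_subset_edges[OF M]
  have c_in: "c \<in> colourings k (card M)" and c_t: "\<And>e. e \<in> edges (card M) \<Longrightarrow> c e \<in> t (nth_elem M ` e)"
    using c unfolding realisations_def sub_template_def by auto
  have inv1: "inv e \<in> edges (card M)" "nth_elem M ` (inv e) = e" if "e \<in> edges_on M" for e
    using that bij_betwE[OF bij_betw_inv_into[OF bij]] bij_betw_inv_into_right[OF bij that]
    unfolding inv_def by auto
  have inv2: "inv (nth_elem M ` e) = e" if "e \<in> edges (card M)" for e
    unfolding inv_def by (rule bij_betw_inv_into_left[OF bij that])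
  have tne: "t e \<noteq> {}" "t e \<subseteq> {1..k}" if "e \<in> edges n" for e
    using PiE_mem[OF t[unfolded templates_def] that] by auto
  have in_t: "c' e \<in> t e" if e: "e \<in> edges n" for e
  proof (cases "e \<in> edges_on M")
    case True
    thus ?thesis using c_t[OF inv1(1)[OF True]] inv1(2)[OF True] by (simp add: c'_def)
  next
    case False
    thus ?thesis using e some_in_eq[of "t e"] tne(1)[OF e] by (simp add: c'_def)
  qed
  have "c' \<in> colourings k n"
    unfolding colourings_def
  proof (rule PiE_I)
    show "c' e \<in> {1..k}" if "e \<in> edges n" for e using in_t[OF that] tne(2)[OF that] by blast
    show "c' e = undefined" if "e \<notin> edges n" for e using that sub by (auto simp: c'_def)
  qed
  moreover have "c' e \<in> t e" if "e \<in> edges n" for e by (rule in_t[OF that])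
  ultimately have 1: "c' \<in> realisations k n t" by (simp add: realisations_def)
  have 2: "col_restrict c' M = c"
  proof (rule ext)
    fix e
    show "col_restrict c' M e = c e"
    proof (cases "e \<in> edges (card M)")
      case True
      thus ?thesis using nth_elem_image_in[OF finM True] inv2[OF True] by (simp add: col_restrict_def c'_def)
    next
      case False
      thus ?thesis using PiE_arb[OF c_in[unfolded colourings_def] False] by (simp add: col_restrict_def)
    qed
  qed
  show thesis by (rule that[OF 1 2])
qed

section \<open>Attainment of the maxima and bounds on entropy\<close>

lemma finite_templates: "finite (templates k n)"
proof -
  have "finite {S. S \<noteq> {} \<and> S \<subseteq> {1..k}}" by (rule finite_subset[of _ "Pow {1..k}"]) auto
  thus ?thesis unfolding templates_def by (intro finite_PiE) auto
qed

lemma ex_ent_ge: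
  assumes "t \<in> templates k n" "realisations k n t \<subseteq> P n"
  shows "Ent k n t \<le> ex_ent k n P"
  unfolding ex_ent_def using assms finite_templates[of k n] by (intro Max_ge) auto

lemma ex_ent_attained:
  assumes "P n \<subseteq> colourings k n" "P n \<noteq> {}"
  obtains t where "t \<in> templates k n" "realisations k n t \<subseteq> P n" "ex_ent k n P = Ent k n t"
proof -
  let ?S = "{Ent k n t | t. t \<in> templates k n \<and> realisations k n t \<subseteq> P n}"
  obtain c where c: "c \<in> P n" "c \<in> colourings k n" using assms by auto
  let ?t = "\<lambda>e\<in>edges n. {c e}"
  have "?t \<in> templates k n" using c(2) by (auto simp: templates_def colourings_def)
  moreover have "realisations k n ?t \<subseteq> {c}"
    using c(2) by (auto simp: realisations_def colourings_def intro: PiE_ext)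
  ultimately have "?S \<noteq> {}" using c(1) by auto
  hence "Max ?S \<in> ?S" using finite_templates[of k n] by (intro Max_in) auto
  thus ?thesis using that by (auto simp: ex_ent_def)
qed

lemma ex_ent_rel_ge:
  assumes "t' \<in> templates k n" "\<forall>e\<in>edges n. t' e \<subseteq> t e" "realisations k n t' \<subseteq> P n"
  shows "Ent k n t' \<le> ex_ent_rel k n t P"
  unfolding ex_ent_rel_def using assms finite_templates[of k n] by (intro Max_ge) auto

lemma ex_ent_rel_attained:
  assumes "s \<in> templates k n" "\<forall>e\<in>edges n. s e \<subseteq> t e" "realisations k n s \<subseteq> P n"
  obtains t' where "t' \<in> templates k n" "\<forall>e\<in>edges n. t' e \<subseteq> t e" "realisations k n t' \<subseteq> P n"
    "ex_ent_rel k n t P = Ent k n t'"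
proof -
  let ?S = "{Ent k n t' | t'. t' \<in> templates k n \<and> (\<forall>e\<in>edges n. t' e \<subseteq> t e) \<and> realisations k n t' \<subseteq> P n}"
  have "?S \<noteq> {}" using assms by auto
  hence "Max ?S \<in> ?S" using finite_templates[of k n] by (intro Max_in) auto
  thus ?thesis using that by (auto simp: ex_ent_rel_def)
qed

lemma log_card_bounds:
  assumes "2 \<le> k" "S \<noteq> {}" "S \<subseteq> {1..k}"
  shows "0 \<le> log (real k) (real (card S))" "log (real k) (real (card S)) \<le> 1"
proof -
  have "finite S" using assms(3) finite_subset by auto
  hence "1 \<le> card S" using assms(2) by (simp add: Suc_le_eq card_gt_0_iff)
  moreover have "card S \<le> k" using card_mono[OF _ assms(3)] by simp
  ultimately show "0 \<le> log (real k) (real (card S))" "log (real k) (real (card S)) \<le> 1"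
    using assms(1) by (auto simp: zero_le_log_cancel_iff log_le_one_cancel_iff)
qed

lemma sum_log_card_bounds:
  assumes "2 \<le> k" "t \<in> templates k n" "A \<subseteq> edges n"
  shows "0 \<le> (\<Sum>e\<in>A. log (real k) (real (card (t e))))"
    "(\<Sum>e\<in>A. log (real k) (real (card (t e)))) \<le> real (card A)"
proof -
  have t: "t e \<noteq> {}" "t e \<subseteq> {1..k}" if "e \<in> A" for e
    using assms that by (auto simp: templates_def PiE_iff)
  show "0 \<le> (\<Sum>e\<in>A. log (real k) (real (card (t e))))"
    using log_card_bounds(1)[OF assms(1)] t by (intro sum_nonneg) auto
  show "(\<Sum>e\<in>A. log (real k) (real (card (t e)))) \<le> real (card A)"
    using sum_bounded_above[of A "\<lambda>e. log (real k) (real (card (t e)))" 1]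
      log_card_bounds(2)[OF assms(1)] t by auto
qed

section \<open>Double counting over vertex sets\<close>

lemma card_supersets:
  assumes "finite S" "A \<subseteq> S" "card A \<le> m"
  shows "card {M. A \<subseteq> M \<and> M \<subseteq> S \<and> card M = m} = (card S - card A) choose (m - card A)"
proof -
  have finA: "finite A" using assms finite_subset by auto
  have "bij_betw (\<lambda>M. M - A) {M. A \<subseteq> M \<and> M \<subseteq> S \<and> card M = m} {B. B \<subseteq> S - A \<and> card B = m - card A}"
  proof (rule bij_betw_byWitness[where f' = "\<lambda>B. B \<union> A"])
    show "(\<lambda>M. M - A) ` {M. A \<subseteq> M \<and> M \<subseteq> S \<and> card M = m} \<subseteq> {B. B \<subseteq> S - A \<and> card B = m - card A}"
      using finA by (auto simp: card_Diff_subset)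
    show "(\<lambda>B. B \<union> A) ` {B. B \<subseteq> S - A \<and> card B = m - card A} \<subseteq> {M. A \<subseteq> M \<and> M \<subseteq> S \<and> card M = m}"
    proof safe
      fix B assume B: "B \<subseteq> S - A" "card B = m - card A"
      have "finite B" using B(1) assms(1) finite_subset by auto
      thus "card (B \<union> A) = m" using B assms(3) finA by (subst card_Un_disjoint) auto
    qed (use assms in auto)
  qed auto
  hence "card {M. A \<subseteq> M \<and> M \<subseteq> S \<and> card M = m} = card {B. B \<subseteq> S - A \<and> card B = m - card A}"
    by (rule bij_betw_same_card)
  also have "\<dots> = card (S - A) choose (m - card A)" using assms by (intro n_subsets) auto
  finally show ?thesis using finA assms(2) by (simp add: card_Diff_subset)
qed

lemma sum_subsets_edges:
  fixes w :: "nat set \<Rightarrow> real"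
  assumes "2 \<le> m"
  shows "(\<Sum>M | M \<subseteq> {1..n} \<and> card M = m. \<Sum>e\<in>edges_on M. w e) =
         real ((n - 2) choose (m - 2)) * (\<Sum>e\<in>edges n. w e)"
proof -
  have "(\<Sum>M | M \<subseteq> {1..n} \<and> card M = m. \<Sum>e\<in>edges_on M. w e) =
        (\<Sum>M | M \<subseteq> {1..n} \<and> card M = m. \<Sum>e\<in>edges n. if e \<subseteq> M then w e else 0)"
  proof (rule sum.cong[OF refl])
    fix M assume M: "M \<in> {M. M \<subseteq> {1..n} \<and> card M = m}"
    show "(\<Sum>e\<in>edges_on M. w e) = (\<Sum>e\<in>edges n. if e \<subseteq> M then w e else 0)"
      using M by (intro sum.mono_neutral_cong_left) (auto simp: edges_on_def edges_def)
  qed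
  also have "\<dots> = (\<Sum>e\<in>edges n. \<Sum>M | M \<subseteq> {1..n} \<and> card M = m. if e \<subseteq> M then w e else 0)"
    by (rule sum.swap)
  also have "\<dots> = (\<Sum>e\<in>edges n. real ((n - 2) choose (m - 2)) * w e)"
  proof (rule sum.cong[OF refl])
    fix e assume e: "e \<in> edges n"
    have "(\<Sum>M | M \<subseteq> {1..n} \<and> card M = m. if e \<subseteq> M then w e else 0) =
          (\<Sum>M | e \<subseteq> M \<and> M \<subseteq> {1..n} \<and> card M = m. w e)"
      by (intro sum.mono_neutral_cong_right) auto
    thus "(\<Sum>M | M \<subseteq> {1..n} \<and> card M = m. if e \<subseteq> M then w e else 0) = real ((n - 2) choose (m - 2)) * w e"
      using card_supersets[of "{1..n}" e m] e assms by (simp add: edges_def)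
  qed
  finally show ?thesis by (simp add: sum_distrib_left)
qed

lemma sub_template_in:
  assumes "t \<in> templates k n" "M \<subseteq> {1..n}"
  shows "sub_template t M \<in> templates k (card M)"
proof -
  have "finite M" using assms(2) finite_subset by auto
  hence "nth_elem M ` e \<in> edges n" if "e \<in> edges (card M)" for e
    using nth_elem_image_in[OF _ that] edges_on_subset_edges[OF assms(2)] by auto
  hence "t (nth_elem M ` e) \<in> {S. S \<noteq> {} \<and> S \<subseteq> {1..k}}" if "e \<in> edges (card M)" for e
    using PiE_mem[OF assms(1)[unfolded templates_def]] that by blast
  thus ?thesis unfolding templates_def sub_template_def by auto
qed

lemma Ent_sub_template:
  assumes "finite M"
  shows "Ent k (card M) (sub_template t M) = (\<Sum>e\<in>edges_on M. log (real k) (real (card (t e))))"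
  using sum.reindex_bij_betw[OF bij_betw_edges_nth_elem[OF assms], of "\<lambda>e. log (real k) (real (card (t e)))"]
  unfolding Ent_def sub_template_def by simp

section \<open>Forbidden copies and supersaturation\<close>

definition graph_on :: "colouring \<Rightarrow> nat set \<Rightarrow> (nat set \<times> nat) set" where
  "graph_on c A = (\<lambda>e. (e, c e)) ` edges_on A"

text \<open>Hyperedges of the container hypergraph, whose vertices are pairs of an edge and a
  colour. The colouring \<open>c\<close> lives on the whole complete graph, but
  \<open>graph_on\<close> keeps only its values inside \<open>A\<close>, so one copy can arise from
  many \<open>c\<close>.\<close>

definition bad_graphs :: "nat \<Rightarrow> nat \<Rightarrow> nat \<Rightarrow> colouring set \<Rightarrow> (nat set \<times> nat) set set" where
  "bad_graphs k n N Q = {graph_on c A | c A. c \<in> colourings k n \<and> A \<subseteq> {1..n} \<and> card A = N \<and>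
     col_restrict c A \<notin> Q}"

lemma finite_bad_graphs: "finite (bad_graphs k n N Q)"
proof -
  have "bad_graphs k n N Q \<subseteq> (\<lambda>(c, A). graph_on c A) ` (colourings k n \<times> Pow {1..n})"
    by (auto simp: bad_graphs_def)
  moreover have "finite (colourings k n)" unfolding colourings_def by (intro finite_PiE) auto
  ultimately show ?thesis by (auto intro: finite_subset)
qed

lemma fst_graph_on: "fst ` graph_on c A = edges_on A"
  by (force simp: graph_on_def)

lemma card_bad_graph:
  assumes "E \<in> bad_graphs k n N Q"
  shows "card E = N choose 2"
proof -
  obtain c A where "E = graph_on c A" "A \<subseteq> {1..n}" "card A = N"
    using assms by (auto simp: bad_graphs_def)
  thus ?thesis
    using card_edges_on[of A] finite_subset[of A "{1..n}"]
    by (simp add: graph_on_def card_image inj_on_def)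
qed

text \<open>A copy inside \<open>t\<close> could be completed, with arbitrary colours from
  \<open>t\<close> elsewhere, to a realisation of \<open>t\<close>; its restriction to the vertices
  of the copy would violate heredity.\<close>

lemma bad_graph_not_in_template:
  assumes t: "t \<in> templates k n" and P: "realisations k n t \<subseteq> P n" and her: "order_hereditary k P"
    and E: "E \<in> bad_graphs k n N (P N)"
  shows "\<not> E \<subseteq> Sigma (edges n) t"
proof
  assume sub: "E \<subseteq> Sigma (edges n) t"
  obtain c A where cA: "E = graph_on c A" "c \<in> colourings k n" "A \<subseteq> {1..n}" "card A = N"
    "col_restrict c A \<notin> P N" using E by (auto simp: bad_graphs_def)
  have finA: "finite A" using cA(3) finite_subset by auto
  define c' where "c' = (\<lambda>e. if e \<in> edges_on A then c e
      else if e \<in> edges n then (SOME x. x \<in> t e) else undefined)"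
  have tne: "t e \<noteq> {}" "t e \<subseteq> {1..k}" if "e \<in> edges n" for e
    using PiE_mem[OF t[unfolded templates_def] that] by auto
  have in_t: "c' e \<in> t e" if e: "e \<in> edges n" for e
  proof (cases "e \<in> edges_on A")
    case True
    thus ?thesis using sub cA(1) by (auto simp: c'_def graph_on_def)
  next
    case False
    thus ?thesis using e some_in_eq[of "t e"] tne(1)[OF e] by (simp add: c'_def)
  qed
  have "c' \<in> colourings k n"
    unfolding colourings_def
  proof (rule PiE_I)
    show "c' e \<in> {1..k}" if "e \<in> edges n" for e using in_t[OF that] tne(2)[OF that] by blast
    show "c' e = undefined" if "e \<notin> edges n" for e
      using that edges_on_subset_edges[OF cA(3)] by (auto simp: c'_def)
  qed
  hence "c' \<in> P n" using in_t P by (auto simp: realisations_def)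
  hence "col_restrict c' A \<in> P N" using her cA(3,4) unfolding order_hereditary_def by blast
  moreover have "col_restrict c' A = col_restrict c A"
    by (rule col_restrict_cong[OF finA]) (simp add: c'_def)
  ultimately show False using cA(5) by simp
qed

lemma card_graphs_on_le:
  assumes "finite A"
  shows "card {graph_on c A | c. \<forall>e\<in>edges_on A. c e \<in> {1..k}} \<le> k ^ (card A choose 2)"
    "finite {graph_on c A | c. \<forall>e\<in>edges_on A. c e \<in> {1..k}}"
proof -
  have sub: "{graph_on c A | c. \<forall>e\<in>edges_on A. c e \<in> {1..k}} \<subseteq> (\<lambda>c. graph_on c A) ` (edges_on A \<rightarrow>\<^sub>E {1..k})"
  proof safe
    fix c assume "\<forall>e\<in>edges_on A. c e \<in> {1..k}"
    hence "restrict c (edges_on A) \<in> edges_on A \<rightarrow>\<^sub>E {1..k}" by auto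
    moreover have "graph_on c A = graph_on (restrict c (edges_on A)) A"
      unfolding graph_on_def by (intro image_cong) auto
    ultimately show "graph_on c A \<in> (\<lambda>c. graph_on c A) ` (edges_on A \<rightarrow>\<^sub>E {1..k})" by blast
  qed
  have fin: "finite (edges_on A \<rightarrow>\<^sub>E {1..k})" using finite_edges_on[OF assms] by (intro finite_PiE) auto
  thus "finite {graph_on c A | c. \<forall>e\<in>edges_on A. c e \<in> {1..k}}" using sub finite_subset by blast
  have "card {graph_on c A | c. \<forall>e\<in>edges_on A. c e \<in> {1..k}} \<le> card ((\<lambda>c. graph_on c A) ` (edges_on A \<rightarrow>\<^sub>E {1..k}))"
    using sub fin by (intro card_mono) auto
  also have "\<dots> \<le> card (edges_on A \<rightarrow>\<^sub>E {1..k})" using fin by (rule card_image_le)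
  also have "\<dots> = k ^ (card A choose 2)"
    using finite_edges_on[OF assms] by (simp add: card_PiE card_edges_on assms)
  finally show "card {graph_on c A | c. \<forall>e\<in>edges_on A. c e \<in> {1..k}} \<le> k ^ (card A choose 2)" .
qed

text \<open>The \<open>N\<close>-set of a copy contains \<open>U\<close>, which leaves at most
  \<open>n ^ (N - s)\<close> choices, and each set has at most \<open>k ^ (N choose 2)\<close>
  coloured graphs. The quotient form avoids truncated subtraction when \<open>s > N\<close>. Degrees
  use \<open>s = 2\<close>, codegrees \<open>s = 3\<close>.\<close>

lemma card_bad_graphs_containing:
  assumes n: "1 \<le> n" and U: "s \<le> card U" "finite U"
    and S: "\<And>E. E \<in> S \<Longrightarrow> E \<in> bad_graphs k n N Q \<and> U \<subseteq> \<Union>(fst ` E)"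
  shows "real (card S) \<le> real k ^ (N choose 2) * (real n ^ N / real n ^ s)"
proof -
  define \<A> where "\<A> = {A. U \<subseteq> A \<and> A \<subseteq> {1..n} \<and> card A = N}"
  define G where "G = (\<lambda>A. {graph_on c A | c. \<forall>e\<in>edges_on A. c e \<in> {1..k}})"
  have fin\<A>: "finite \<A>" unfolding \<A>_def by (rule finite_subset[of _ "Pow {1..n}"]) auto
  have finA: "finite A" if "A \<in> \<A>" for A using that finite_subset unfolding \<A>_def by auto
  have "S \<subseteq> (\<Union>A\<in>\<A>. G A)"
  proof
    fix E assume E: "E \<in> S"
    then obtain c A where cA: "E = graph_on c A" "c \<in> colourings k n" "A \<subseteq> {1..n}" "card A = N"
      using S[OF E] by (auto simp: bad_graphs_def)
    have "U \<subseteq> A" using S[OF E] cA(1) by (auto simp: fst_graph_on edges_on_def)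
    moreover have "\<forall>e\<in>edges_on A. c e \<in> {1..k}"
      using cA(2) edges_on_subset_edges[OF cA(3)] unfolding colourings_def by (blast dest: PiE_mem)
    ultimately show "E \<in> (\<Union>A\<in>\<A>. G A)" using cA unfolding \<A>_def G_def by blast
  qed
  moreover have "finite (\<Union>A\<in>\<A>. G A)"
    using fin\<A> finA card_graphs_on_le(2) unfolding G_def by blast
  ultimately have "card S \<le> card (\<Union>A\<in>\<A>. G A)" by (rule card_mono[rotated])
  also have "\<dots> \<le> (\<Sum>A\<in>\<A>. card (G A))" by (rule card_UN_le[OF fin\<A>])
  also have "\<dots> \<le> card \<A> * k ^ (N choose 2)"
  proof -
    have "card (G A) \<le> k ^ (N choose 2)" if "A \<in> \<A>" for A
      using card_graphs_on_le(1)[OF finA[OF that], of k] that unfolding G_def \<A>_def by simp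
    thus ?thesis using sum_bounded_above[of \<A> "\<lambda>A. card (G A)" "k ^ (N choose 2)"] by simp
  qed
  finally have "real (card S) \<le> real (card \<A>) * real k ^ (N choose 2)"
    by (metis of_nat_le_iff of_nat_mult of_nat_power)
  moreover have "real (card \<A>) \<le> real n ^ N / real n ^ s"
  proof (cases "\<A> = {}")
    case True
    thus ?thesis by simp
  next
    case False
    then obtain A where A: "U \<subseteq> A" "A \<subseteq> {1..n}" "card A = N" by (auto simp: \<A>_def)
    have UN: "card U \<le> N" using card_mono[OF _ A(1)] A(3) finite_subset[OF A(2)] by auto
    have Un: "card U \<le> n" using card_mono[of "{1..n}" U] A by auto
    have "card \<A> = (n - card U) choose (N - card U)"
      using card_supersets[of "{1..n}" U N] A UN by (simp add: \<A>_def)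
    also have "\<dots> \<le> (n - card U) ^ (N - card U)"
      by (cases "N - card U \<le> n - card U") (auto simp: binomial_le_pow binomial_eq_0)
    also have "\<dots> \<le> n ^ (N - card U)" by (intro power_mono) auto
    also have "\<dots> \<le> n ^ (N - s)" using U n by (intro power_increasing) auto
    finally have "real (card \<A>) \<le> real n ^ (N - s)" by (metis of_nat_le_iff of_nat_power)
    also have "\<dots> = real n ^ N / real n ^ s" using n U UN by (simp add: power_diff)
    finally show ?thesis .
  qed
  ultimately show ?thesis
    by (metis (no_types, opaque_lifting) mult.commute mult_left_mono of_nat_0_le_iff of_nat_power order_trans)
qed

lemma ex_ent_nonneg:
  assumes "2 \<le> k" "order_hereditary k P" "P n \<noteq> {}"
  shows "0 \<le> ex_ent k n P"
proof -
  have "P n \<subseteq> colourings k n" using assms(2) by (simp add: order_hereditary_def)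
  then obtain t where "t \<in> templates k n" "realisations k n t \<subseteq> P n" "ex_ent k n P = Ent k n t"
    using assms(3) by (rule ex_ent_attained)
  thus ?thesis using sum_log_card_bounds(1)[OF assms(1)] by (simp add: Ent_def)
qed

text \<open>A bad realisation of the sub-template lifts to a realisation of \<open>t\<close>; the
  offending \<open>N\<close>-set of indices, mapped by \<open>nth_elem M\<close>, is the vertex set
  of a copy inside \<open>M\<close>.\<close>

lemma bad_graph_in_sub_template:
  assumes her: "order_hereditary k P" and forb: "defined_by_forbidden k N P"
    and t: "t \<in> templates k n" and M: "M \<subseteq> {1..n}" "N \<le> card M"
    and bad: "\<not> realisations k (card M) (sub_template t M) \<subseteq> P (card M)"
  shows "\<exists>c A. A \<subseteq> M \<and> card A = N \<and> graph_on c A \<in> bad_graphs k n N (P N) \<and>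
    graph_on c A \<subseteq> Sigma (edges n) t"
proof -
  have finM: "finite M" using M finite_subset by auto
  obtain c where c: "c \<in> realisations k (card M) (sub_template t M)" "c \<notin> P (card M)" using bad by auto
  obtain c' where c': "c' \<in> realisations k n t" "col_restrict c' M = c"
    using realisations_lift[OF t M(1) c(1)] by blast
  have "c \<in> colourings k (card M)" using c(1) by (auto simp: realisations_def)
  then obtain B where B: "B \<subseteq> {1..card M}" "card B = N" "col_restrict c B \<notin> P N"
    using mem_property_iff[OF her forb M(2)] c(2) by blast
  define A where "A = nth_elem M ` B"
  have A: "A \<subseteq> M" "card A = N" "col_restrict c' A \<notin> P N"
    using nth_elem_subset[OF finM B(1)] B col_restrict_col_restrict[OF finM B(1), of c'] c'(2)
    by (auto simp: A_def)
  have c'col: "c' \<in> colourings k n" and c't: "\<And>e. e \<in> edges n \<Longrightarrow> c' e \<in> t e"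
    using c'(1) by (auto simp: realisations_def)
  have "graph_on c' A \<in> bad_graphs k n N (P N)"
    unfolding bad_graphs_def using c'col A M(1) by blast
  moreover have "graph_on c' A \<subseteq> Sigma (edges n) t"
    using c't edges_on_subset_edges[of A n] A(1) M(1) by (auto simp: graph_on_def)
  ultimately show ?thesis using A by blast
qed

text \<open>Averaging over \<open>m\<close>-sets: a proportion of at least \<open>\<epsilon>\<close>
  of them is rich, with weight above \<open>ex_ent k m P\<close>, so each of these contains a bad
  copy; and a fixed \<open>N\<close>-set lies in only \<open>(n - N) choose (m - N)\<close> of the
  \<open>m\<close>-sets.\<close>

lemma supersaturation_sets:
  assumes k: "2 \<le> k" and her: "order_hereditary k P" and forb: "defined_by_forbidden k N P"
    and N: "2 \<le> N" "N \<le> m" and mn: "m \<le> n" and t: "t \<in> templates k n"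
    and big: "(ex_ent k m P / real (m choose 2) + \<epsilon>) * real (n choose 2) \<le> Ent k n t"
    and e0: "0 \<le> \<epsilon>" and em: "0 \<le> ex_ent k m P"
  shows "\<epsilon> * real (n choose N) \<le> real (m choose N) * real (card {E \<in> bad_graphs k n N (P N). E \<subseteq> Sigma (edges n) t})"
proof -
  let ?w = "\<lambda>e. log (real k) (real (card (t e)))"
  let ?x = "ex_ent k m P"
  define \<M> where "\<M> = {M. M \<subseteq> {1..n} \<and> card M = m}"
  define \<G> where "\<G> = {M \<in> \<M>. ?x < (\<Sum>e\<in>edges_on M. ?w e)}"
  define \<B> where "\<B> = {A. A \<subseteq> {1..n} \<and> card A = N \<and> (\<exists>c. graph_on c A \<in> bad_graphs k n N (P N) \<and>
    graph_on c A \<subseteq> Sigma (edges n) t)}"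
  have fin\<M>: "finite \<M>" unfolding \<M>_def by (rule finite_subset[of _ "Pow {1..n}"]) auto
  have fin\<B>: "finite \<B>" unfolding \<B>_def by (rule finite_subset[of _ "Pow {1..n}"]) auto
  have c\<M>: "card \<M> = n choose m" using n_subsets[of "{1..n}" m] by (simp add: \<M>_def)
  have m2: "2 \<le> m" using N by simp
  have mpos: "0 < real (m choose 2)" and npos: "0 < real (n choose 2)"
    using m2 mn by (auto simp: zero_less_binomial_iff)
  have id2: "(n choose m) * (m choose 2) = (n choose 2) * ((n - 2) choose (m - 2))"
    by (rule choose_mult[OF m2 mn])
  have idN: "(n choose m) * (m choose N) = (n choose N) * ((n - N) choose (m - N))"
    by (rule choose_mult[OF N(2) mn])
  have "real ((n - 2) choose (m - 2)) * Ent k n t = (\<Sum>M\<in>\<M>. \<Sum>e\<in>edges_on M. ?w e)"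
    using sum_subsets_edges[OF m2, where n = n and w = ?w] by (simp add: Ent_def \<M>_def)
  \<comment> \<open>A set outside \<open>\<G>\<close> contributes at most \<open>?x\<close>; a rich
    one at most \<open>m choose 2\<close>, as logarithms to base \<open>k\<close> are at most
    \<open>1\<close>.\<close>
  also have "\<dots> \<le> (\<Sum>M\<in>\<M>. ?x + (if M \<in> \<G> then real (m choose 2) else 0))"
  proof (rule sum_mono)
    fix M assume M: "M \<in> \<M>"
    hence "finite M" using finite_subset unfolding \<M>_def by auto
    hence "(\<Sum>e\<in>edges_on M. ?w e) \<le> real (m choose 2)"
      using sum_log_card_bounds(2)[OF k t edges_on_subset_edges, of M] M
      by (simp add: \<M>_def card_edges_on)
    thus "(\<Sum>e\<in>edges_on M. ?w e) \<le> ?x + (if M \<in> \<G> then real (m choose 2) else 0)"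
      using M em by (auto simp: \<G>_def)
  qed
  also have "\<dots> = real (n choose m) * ?x + real (card \<G>) * real (m choose 2)"
  proof -
    have "(\<Sum>M\<in>\<M>. if M \<in> \<G> then real (m choose 2) else 0) = (\<Sum>M\<in>\<G>. real (m choose 2))"
      using fin\<M> by (intro sum.mono_neutral_cong_right) (auto simp: \<G>_def)
    thus ?thesis by (simp add: sum.distrib c\<M>)
  qed
  finally have 1: "real ((n - 2) choose (m - 2)) * Ent k n t \<le> real (n choose m) * ?x + real (card \<G>) * real (m choose 2)" .
  have "real ((n - 2) choose (m - 2)) * ((?x / real (m choose 2) + \<epsilon>) * real (n choose 2))
      \<le> real ((n - 2) choose (m - 2)) * Ent k n t"
    using big by (intro mult_left_mono) auto
  also have "real ((n - 2) choose (m - 2)) * ((?x / real (m choose 2) + \<epsilon>) * real (n choose 2)) =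
      (?x / real (m choose 2) + \<epsilon>) * real ((n choose 2) * ((n - 2) choose (m - 2)))"
    by simp
  also have "\<dots> = (?x / real (m choose 2) + \<epsilon>) * (real (n choose m) * real (m choose 2))"
    unfolding id2[symmetric] by simp
  also have "\<dots> = real (n choose m) * ?x + \<epsilon> * real (n choose m) * real (m choose 2)"
    using mpos by (simp add: field_simps)
  finally have "\<epsilon> * real (n choose m) * real (m choose 2) \<le> real (card \<G>) * real (m choose 2)" using 1 by simp
  hence 2: "\<epsilon> * real (n choose m) \<le> real (card \<G>)" using mpos by simp
  have "\<G> \<subseteq> (\<Union>A\<in>\<B>. {M. A \<subseteq> M \<and> M \<subseteq> {1..n} \<and> card M = m})"
  proof
    fix M assume MG: "M \<in> \<G>"
    hence M: "M \<subseteq> {1..n}" "card M = m" "?x < (\<Sum>e\<in>edges_on M. ?w e)" by (auto simp: \<G>_def \<M>_def)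
    have finM: "finite M" using M(1) finite_subset by auto
    have "\<not> realisations k m (sub_template t M) \<subseteq> P m"
    proof
      assume "realisations k m (sub_template t M) \<subseteq> P m"
      hence "Ent k m (sub_template t M) \<le> ?x"
        using sub_template_in[OF t M(1)] M(2) by (intro ex_ent_ge) auto
      thus False using Ent_sub_template[OF finM, of k t] M by simp
    qed
    then obtain c A where "A \<subseteq> M" "card A = N" "graph_on c A \<in> bad_graphs k n N (P N)"
      "graph_on c A \<subseteq> Sigma (edges n) t"
      using bad_graph_in_sub_template[OF her forb t M(1)] M(2) N(2) by blast
    thus "M \<in> (\<Union>A\<in>\<B>. {M. A \<subseteq> M \<and> M \<subseteq> {1..n} \<and> card M = m})"
      using M(1,2) unfolding \<B>_def by blast
  qed
  hence "card \<G> \<le> card (\<Union>A\<in>\<B>. {M. A \<subseteq> M \<and> M \<subseteq> {1..n} \<and> card M = m})"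
    using fin\<B> by (intro card_mono finite_UN_I) (auto intro: finite_subset[of _ "Pow {1..n}"])
  also have "\<dots> \<le> (\<Sum>A\<in>\<B>. card {M. A \<subseteq> M \<and> M \<subseteq> {1..n} \<and> card M = m})" by (rule card_UN_le[OF fin\<B>])
  also have "\<dots> = (\<Sum>A\<in>\<B>. (n - N) choose (m - N))"
    using card_supersets[of "{1..n}" _ m] N(2) by (intro sum.cong refl) (auto simp: \<B>_def)
  finally have 3: "card \<G> \<le> card \<B> * ((n - N) choose (m - N))" by simp
  \<comment> \<open>One copy is chosen for each \<open>N\<close>-set; the edges of a copy determine
    its set, so the choice is injective.\<close>
  have "card \<B> \<le> card {E \<in> bad_graphs k n N (P N). E \<subseteq> Sigma (edges n) t}"
  proof -
    obtain f where f: "\<And>A. A \<in> \<B> \<Longrightarrow> graph_on (f A) A \<in> bad_graphs k n N (P N) \<and> graph_on (f A) A \<subseteq> Sigma (edges n) t"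
      using bchoice[of \<B> "\<lambda>A c. graph_on c A \<in> bad_graphs k n N (P N) \<and> graph_on c A \<subseteq> Sigma (edges n) t"]
      unfolding \<B>_def by blast
    have "inj_on (\<lambda>A. graph_on (f A) A) \<B>"
    proof (rule inj_onI)
      fix A A' assume A: "A \<in> \<B>" "A' \<in> \<B>" "graph_on (f A) A = graph_on (f A') A'"
      have "\<Union>(edges_on X) = X" if "X \<in> \<B>" for X
      proof (rule Union_edges_on)
        have "X \<subseteq> {1..n} \<and> card X = N" using that unfolding \<B>_def by blast
        thus "finite X" "2 \<le> card X" using N(1) finite_subset by auto
      qed
      note U = this
      have e: "edges_on A = edges_on A'" using arg_cong[OF A(3), of "image fst"] by (simp only: fst_graph_on)
      have "A = \<Union>(edges_on A)" by (rule U[OF A(1), symmetric])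
      also have "\<dots> = A'" unfolding e by (rule U[OF A(2)])
      finally show "A = A'" .
    qed
    moreover have "(\<lambda>A. graph_on (f A) A) ` \<B> \<subseteq> {E \<in> bad_graphs k n N (P N). E \<subseteq> Sigma (edges n) t}"
      using f by blast
    moreover have "finite {E \<in> bad_graphs k n N (P N). E \<subseteq> Sigma (edges n) t}"
      by (rule finite_subset[OF _ finite_bad_graphs]) blast
    ultimately show ?thesis by (rule card_inj_on_le)
  qed
  hence 4: "card \<G> \<le> card {E \<in> bad_graphs k n N (P N). E \<subseteq> Sigma (edges n) t} * ((n - N) choose (m - N))"
    using 3 by (meson le_trans mult_le_mono1)
  let ?b = "real (card {E \<in> bad_graphs k n N (P N). E \<subseteq> Sigma (edges n) t})"
  let ?q = "real ((n - N) choose (m - N))"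
  have qpos: "0 < ?q" using mn N by (simp add: zero_less_binomial_iff)
  have "\<epsilon> * real (n choose N) * ?q = \<epsilon> * real (n choose m) * real (m choose N)"
    using arg_cong[OF idN, of real] by simp
  also have "\<dots> \<le> real (card \<G>) * real (m choose N)" using 2 by (intro mult_right_mono) auto
  also have "\<dots> \<le> (?b * ?q) * real (m choose N)"
    using of_nat_mono[OF 4, where ?'a = real] by (intro mult_right_mono) simp_all
  finally have "\<epsilon> * real (n choose N) * ?q \<le> (real (m choose N) * ?b) * ?q" by (simp add: mult_ac)
  thus ?thesis using qpos by simp
qed

text \<open>A sample size \<open>m\<close> whose density \<open>x m\<close> is within
  \<open>\<epsilon>\<close> of the infimum over all sizes exceeds the density of every
  \<open>n \<ge> N\<close> by at most \<open>\<epsilon>\<close>. This fixes \<open>m\<close>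
  independently of \<open>n\<close>.\<close>

lemma supersaturation:
  assumes k: "2 \<le> k" and her: "order_hereditary k P" and forb: "defined_by_forbidden k N P"
    and ne: "\<And>n. P n \<noteq> {}" and N: "2 \<le> N" and \<epsilon>: "0 < \<epsilon>"
  shows "\<exists>\<delta>>0. \<exists>n0. \<forall>n\<ge>n0. \<forall>t\<in>templates k n. ex_ent k n P + \<epsilon> * (real n)\<^sup>2 < Ent k n t \<longrightarrow>
    \<delta> * real n ^ N \<le> real (card {E \<in> bad_graphs k n N (P N). E \<subseteq> Sigma (edges n) t})"
proof -
  define x where "x = (\<lambda>m. ex_ent k m P / real (m choose 2))"
  have x0: "0 \<le> x m" for m using ex_ent_nonneg[OF k her ne] by (simp add: x_def)
  have "\<exists>m\<ge>N. x m < Inf (x ` {N..}) + \<epsilon>"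
    using cInf_lessD[of "x ` {N..}" "Inf (x ` {N..}) + \<epsilon>"] \<epsilon> by auto
  then obtain m where m: "N \<le> m" "x m < Inf (x ` {N..}) + \<epsilon>" by auto
  \<comment> \<open>\<open>m choose N\<close> comes from the averaging, \<open>N ^ N\<close> from
    \<open>(n / N) ^ N \<le> n choose N\<close>.\<close>
  define \<delta> where "\<delta> = \<epsilon> / (real (m choose N) * real N ^ N)"
  have mN: "0 < real (m choose N)" using m by (simp add: zero_less_binomial_iff)
  have "0 < \<delta>" using \<epsilon> mN N by (simp add: \<delta>_def)
  moreover have "\<delta> * real n ^ N \<le> real (card {E \<in> bad_graphs k n N (P N). E \<subseteq> Sigma (edges n) t})"
    if n: "m \<le> n" and t: "t \<in> templates k n" and big: "ex_ent k n P + \<epsilon> * (real n)\<^sup>2 < Ent k n t" for n t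
  proof -
    let ?b = "real (card {E \<in> bad_graphs k n N (P N). E \<subseteq> Sigma (edges n) t})"
    have npos: "0 < real (n choose 2)" using N m n by (simp add: zero_less_binomial_iff)
    have "Inf (x ` {N..}) \<le> x n" using x0 m n by (intro cInf_lower) (auto intro!: bdd_belowI[of _ 0])
    hence "x m \<le> x n + \<epsilon>" using m by simp
    \<comment> \<open>One \<open>\<epsilon>\<close> pays for the choice of \<open>m\<close>, the
      other is the excess handed to the averaging; together they cost
      \<open>2 * \<epsilon> * (n choose 2) \<le> \<epsilon> * n ^ 2\<close>.\<close>
    hence "(x m + \<epsilon>) * real (n choose 2) \<le> (x n + 2 * \<epsilon>) * real (n choose 2)"
      by (intro mult_right_mono) auto
    also have "\<dots> = ex_ent k n P + \<epsilon> * (2 * real (n choose 2))" using npos by (simp add: x_def field_simps)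
    also have "\<dots> \<le> ex_ent k n P + \<epsilon> * (real n)\<^sup>2"
    proof -
      have "2 * (n choose 2) \<le> n * (n - 1)" unfolding choose_two by (rule times_div_less_eq_dividend)
      also have "\<dots> \<le> n * n" by simp
      finally have "2 * (n choose 2) \<le> n * n" .
      hence "2 * real (n choose 2) \<le> (real n)\<^sup>2"
        by (metis of_nat_le_iff of_nat_mult of_nat_numeral power2_eq_square)
      thus ?thesis using \<epsilon> by (intro add_left_mono mult_left_mono) auto
    qed
    finally have "(x m + \<epsilon>) * real (n choose 2) \<le> Ent k n t" using big by simp
    hence "\<epsilon> * real (n choose N) \<le> real (m choose N) * ?b"
      using supersaturation_sets[OF k her forb N m(1) n t, of \<epsilon>] \<epsilon> ex_ent_nonneg[OF k her ne] by (simp add: x_def)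
    moreover have "(real n / real N) ^ N \<le> real (n choose N)"
      using m(1) n by (intro binomial_ge_n_over_k_pow_k) simp
    hence "\<epsilon> * (real n / real N) ^ N \<le> \<epsilon> * real (n choose N)" using \<epsilon> by (intro mult_left_mono) auto
    ultimately have "\<epsilon> * (real n / real N) ^ N \<le> real (m choose N) * ?b" by linarith
    thus ?thesis using mN N by (simp add: \<delta>_def field_simps power_divide)
  qed
  ultimately show ?thesis by blast
qed

section \<open>The hypergraph of bad copies and its containers\<close>

lemma wdeg_of_bool:
  assumes "finite V"
  shows "wdeg V (\<lambda>E. of_bool (E \<in> S)) F = real (card {E \<in> S. E \<subseteq> V \<and> F \<subseteq> E})"
proof -
  have "finite {E. E \<subseteq> V \<and> F \<subseteq> E}" using assms by (auto intro: finite_subset[of _ "Pow V"])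
  hence "wdeg V (\<lambda>E. of_bool (E \<in> S)) F = real (card ({E. E \<subseteq> V \<and> F \<subseteq> E} \<inter> {E. E \<in> S}))"
    unfolding wdeg_def by (simp add: sum_of_bool_eq)
  also have "{E. E \<subseteq> V \<and> F \<subseteq> E} \<inter> {E. E \<in> S} = {E \<in> S. E \<subseteq> V \<and> F \<subseteq> E}" by auto
  finally show ?thesis .
qed

text \<open>\<open>k * n ^ 2\<close> bounds the number of pairs and
  \<open>k ^ Suc j * n ^ (N - 2)\<close> the copies through one edge. Two distinct pairs in one copy
  have different edges, which span at least three vertices, so codegrees are smaller than this by a
  factor \<open>n\<close>; the hypothesis \<open>q\<close> turns that factor into a power of
  \<open>b / v\<close>.\<close>

lemma bounded_codegree_bad_graphs:
  assumes n: "1 \<le> n" and k: "1 \<le> k" and b: "1 \<le> b" and N: "N choose 2 = Suc j"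
    and q: "1 / real n \<le> (real b / (real k * (real n)\<^sup>2)) ^ j"
  shows "bounded_codegree j b (real k * (real n)\<^sup>2) (real k ^ Suc j * (real n ^ N / (real n)\<^sup>2))
           (edges n \<times> {1..k}) (\<lambda>E. of_bool (E \<in> bad_graphs k n N Q))"
proof -
  let ?V = "edges n \<times> {1..k}" and ?B = "bad_graphs k n N Q"
  let ?d = "real k ^ Suc j * (real n ^ N / (real n)\<^sup>2)"
  have finV: "finite ?V" by simp
  have d0: "0 < ?d" using n k by simp
  have "n choose 2 \<le> n ^ 2" by (cases "2 \<le> n") (auto simp: binomial_le_pow binomial_eq_0)
  hence "real (n choose 2) \<le> (real n)\<^sup>2" by (metis of_nat_le_iff of_nat_power)
  hence cV: "real (card ?V) \<le> real k * (real n)\<^sup>2"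
    using k by (simp add: card_cartesian_product card_edges mult.commute)
  have deg: "wdeg ?V (\<lambda>E. of_bool (E \<in> ?B)) {x} \<le> ?d" for x
  proof (cases "x \<in> ?V")
    case True
    hence e: "card (fst x) = 2" "finite (fst x)" by (auto simp: edges_def intro: card_ge_0_finite)
    have "real (card {E \<in> ?B. E \<subseteq> ?V \<and> {x} \<subseteq> E}) \<le> real k ^ (N choose 2) * (real n ^ N / real n ^ 2)"
      by (rule card_bad_graphs_containing[OF n, of 2 "fst x" _ k N Q]) (use e in auto)
    thus ?thesis unfolding wdeg_of_bool[OF finV] by (simp add: N)
  next
    case False
    hence "wdeg ?V (\<lambda>E. of_bool (E \<in> ?B)) {x} = 0" by (intro wdeg_outside) auto
    thus ?thesis using d0 by simp
  qed
  have codeg: "wdeg ?V (\<lambda>E. of_bool (E \<in> ?B)) {x, y} \<le> ?d / real n" if xy: "x \<noteq> y" for x y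
  proof (cases "{E \<in> ?B. E \<subseteq> ?V \<and> {x, y} \<subseteq> E} = {}")
    case True
    thus ?thesis unfolding wdeg_of_bool[OF finV] True using d0 by simp
  next
    case False
    then obtain E where E: "E \<in> ?B" "E \<subseteq> ?V" "x \<in> E" "y \<in> E" by auto
    then obtain c A where "E = graph_on c A" by (auto simp: bad_graphs_def)
    hence ne: "fst x \<noteq> fst y" using E xy by (auto simp: graph_on_def)
    have "fst x \<in> edges n" "fst y \<in> edges n" using E by auto
    hence e: "card (fst x) = 2" "finite (fst x)" "card (fst y) = 2" "finite (fst y)"
      by (auto simp: edges_def intro: card_ge_0_finite)
    have "\<not> fst y \<subseteq> fst x" using ne card_subset_eq[of "fst x" "fst y"] e by auto
    hence "fst x \<subset> fst x \<union> fst y" by auto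
    hence "card (fst x) < card (fst x \<union> fst y)" using e by (intro psubset_card_mono) auto
    hence c3: "3 \<le> card (fst x \<union> fst y)" using e by simp
    have "real (card {E \<in> ?B. E \<subseteq> ?V \<and> {x, y} \<subseteq> E}) \<le> real k ^ (N choose 2) * (real n ^ N / real n ^ 3)"
      by (rule card_bad_graphs_containing[OF n c3, of _ k N Q]) (use e in auto)
    also have "\<dots> = ?d / real n" by (simp add: N power2_eq_square power3_eq_cube)
    finally show ?thesis unfolding wdeg_of_bool[OF finV] .
  qed
  have codeg': "wdeg ?V (\<lambda>E. of_bool (E \<in> ?B)) {x, y} \<le> (real b / (real k * (real n)\<^sup>2)) ^ j * ?d"
    if xy: "x \<noteq> y" for x y
  proof -
    have "?d / real n = 1 / real n * ?d" by simp
    also have "\<dots> \<le> (real b / (real k * (real n)\<^sup>2)) ^ j * ?d"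
      by (rule mult_right_mono[OF q less_imp_le[OF d0]])
    finally have "?d / real n \<le> (real b / (real k * (real n)\<^sup>2)) ^ j * ?d" .
    with codeg[OF xy] show ?thesis by (rule order_trans)
  qed
  show ?thesis
    unfolding bounded_codegree_def
  proof (intro conjI allI impI)
    show "0 < real k * (real n)\<^sup>2" using n k by simp
    show "card E = Suc j" if "of_bool (E \<in> ?B) \<noteq> (0::real)" for E
      using that card_bad_graph[of E k n N Q] N by (simp split: if_splits)
  qed (fact finV cV d0 b deg codeg' | simp)+
qed

text \<open>A container, read edge by edge as a set of allowed colours, contains few bad copies; by
  the contrapositive of supersaturation its entropy is close to \<open>ex_ent k n P\<close> at
  most.\<close>

lemma template_containers:
  assumes k: "2 \<le> k" and her: "order_hereditary k P" and forb: "defined_by_forbidden k N P"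
    and ne: "\<And>n. P n \<noteq> {}" and N: "N choose 2 = Suc j" and \<epsilon>: "0 < \<epsilon>"
  shows "\<exists>\<alpha>>0. \<exists>L M. \<forall>n\<ge>M. \<forall>b\<ge>1. real b / (real k * (real n)\<^sup>2) \<le> \<alpha> \<longrightarrow>
      1 / real n \<le> (real b / (real k * (real n)\<^sup>2)) ^ j \<longrightarrow>
    (\<exists>\<T>. finite \<T> \<and> \<T> \<subseteq> templates k n \<and> card \<T> \<le> (k * n\<^sup>2 + 1) ^ (b * j * L) \<and>
      (\<forall>t\<in>\<T>. Ent k n t \<le> ex_ent k n P + \<epsilon> * (real n)\<^sup>2) \<and>
      (\<forall>t\<in>templates k n. realisations k n t \<subseteq> P n \<longrightarrow> (\<exists>t'\<in>\<T>. \<forall>e\<in>edges n. t e \<subseteq> t' e)))"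
proof -
  have N2: "2 \<le> N" using N by (cases "2 \<le> N") (auto simp: binomial_eq_0)
  obtain \<delta> n1 where \<delta>: "0 < \<delta>" and sup: "\<forall>n\<ge>n1. \<forall>t\<in>templates k n. ex_ent k n P + \<epsilon> * (real n)\<^sup>2 < Ent k n t \<longrightarrow>
    \<delta> * real n ^ N \<le> real (card {E \<in> bad_graphs k n N (P N). E \<subseteq> Sigma (edges n) t})"
    using supersaturation[OF k her forb ne N2 \<epsilon>] by blast
  \<comment> \<open>Here \<open>v * d = k ^ Suc (Suc j) * n ^ N\<close>, so a container holds fewer
    than \<open>\<delta> * n ^ N\<close> copies; the cap \<open>1\<close> is for
    \<open>containers\<close>.\<close>
  define c where "c = min 1 (\<delta> / real k ^ Suc (Suc j))"
  have c: "0 < c" "c \<le> 1" "c * real k ^ Suc (Suc j) \<le> \<delta>"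
  proof -
    have kp: "0 < real k ^ Suc (Suc j)" using k by simp
    show "0 < c" using \<delta> kp by (simp add: c_def)
    show "c \<le> 1" by (simp add: c_def)
    have "c * real k ^ Suc (Suc j) \<le> \<delta> / real k ^ Suc (Suc j) * real k ^ Suc (Suc j)"
      using kp by (intro mult_right_mono) (auto simp: c_def)
    thus "c * real k ^ Suc (Suc j) \<le> \<delta>" using kp k by simp
  qed
  obtain \<alpha> L where \<alpha>: "0 < \<alpha>" and cont: "\<And>(V::(nat set \<times> nat) set) h d b v. bounded_codegree j b v d V h \<Longrightarrow> real b / v \<le> \<alpha> \<Longrightarrow>
    (\<exists>\<C>. finite \<C> \<and> card \<C> \<le> (card V + 1) ^ (b * j * L) \<and>
        (\<forall>C\<in>\<C>. C \<subseteq> V \<and> wdeg C h {} < c * v * d) \<and>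
        (\<forall>I\<subseteq>V. (\<forall>E\<subseteq>I. h E = 0) \<longrightarrow> (\<exists>C\<in>\<C>. I \<subseteq> C)))"
    using containers[OF c(1,2), where ?'a = "nat set \<times> nat" and j = j] by blast
  have main: "\<exists>\<T>. finite \<T> \<and> \<T> \<subseteq> templates k n \<and> card \<T> \<le> (k * n\<^sup>2 + 1) ^ (b * j * L) \<and>
      (\<forall>t\<in>\<T>. Ent k n t \<le> ex_ent k n P + \<epsilon> * (real n)\<^sup>2) \<and>
      (\<forall>t\<in>templates k n. realisations k n t \<subseteq> P n \<longrightarrow> (\<exists>t'\<in>\<T>. \<forall>e\<in>edges n. t e \<subseteq> t' e))"
    if n: "max n1 1 \<le> n" and b: "1 \<le> b" "real b / (real k * (real n)\<^sup>2) \<le> \<alpha>"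
      and q: "1 / real n \<le> (real b / (real k * (real n)\<^sup>2)) ^ j" for n b
  proof -
    define V where "V = edges n \<times> {1..k}"
    define h where "h = (\<lambda>E. of_bool (E \<in> bad_graphs k n N (P N)) :: real)"
    have finV: "finite V" by (simp add: V_def)
    have "bounded_codegree j b (real k * (real n)\<^sup>2) (real k ^ Suc j * (real n ^ N / (real n)\<^sup>2)) V h"
      unfolding V_def h_def by (rule bounded_codegree_bad_graphs) (use n k b N q in auto)
    from cont[OF this b(2)] obtain \<C> where C0: "finite \<C> \<and> card \<C> \<le> (card V + 1) ^ (b * j * L) \<and>
        (\<forall>C\<in>\<C>. C \<subseteq> V \<and> wdeg C h {} < c * (real k * (real n)\<^sup>2) * (real k ^ Suc j * (real n ^ N / (real n)\<^sup>2))) \<and>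
        (\<forall>I\<subseteq>V. (\<forall>E\<subseteq>I. h E = 0) \<longrightarrow> (\<exists>C\<in>\<C>. I \<subseteq> C))"
      by (rule exE)
    have C: "finite \<C>" "card \<C> \<le> (card V + 1) ^ (b * j * L)"
      using C0 by (blast, blast)
    have C3: "C \<subseteq> V" and C4: "wdeg C h {} < c * (real k * (real n)\<^sup>2) * (real k ^ Suc j * (real n ^ N / (real n)\<^sup>2))"
      if "C \<in> \<C>" for C
      using C0 that by (blast, blast)
    have C5: "\<exists>C\<in>\<C>. I \<subseteq> C" if "I \<subseteq> V" "\<forall>E\<subseteq>I. h E = 0" for I
      using C0 that by blast
    define \<phi> :: "(nat set \<times> nat) set \<Rightarrow> template" where "\<phi> = (\<lambda>C. \<lambda>e\<in>edges n. {x. (e, x) \<in> C})"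
    have Sig: "Sigma (edges n) (\<phi> C) = C" if "C \<in> \<C>" for C
      using C3[OF that] by (auto simp: \<phi>_def V_def)
    show ?thesis
    \<comment> \<open>A container may leave some edge without a colour and is then dropped; one that
      covers a template leaves no edge empty.\<close>
    proof (intro exI[of _ "\<phi> ` \<C> \<inter> templates k n"] conjI ballI impI)
      show "finite (\<phi> ` \<C> \<inter> templates k n)" using C(1) by simp
      show "\<phi> ` \<C> \<inter> templates k n \<subseteq> templates k n" by simp
      have "card V \<le> k * n\<^sup>2"
      proof -
        have "n choose 2 \<le> n ^ 2" by (cases "2 \<le> n") (auto simp: binomial_le_pow binomial_eq_0)
        thus ?thesis by (simp add: V_def card_cartesian_product card_edges mult.commute)
      qed
      hence "(card V + 1) ^ (b * j * L) \<le> (k * n\<^sup>2 + 1) ^ (b * j * L)" by (intro power_mono) auto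
      moreover have "card (\<phi> ` \<C> \<inter> templates k n) \<le> card (\<phi> ` \<C>)" using C(1) by (intro card_mono) auto
      moreover have "card (\<phi> ` \<C>) \<le> card \<C>" using C(1) by (rule card_image_le)
      ultimately show "card (\<phi> ` \<C> \<inter> templates k n) \<le> (k * n\<^sup>2 + 1) ^ (b * j * L)" using C(2) by linarith
    next
      fix t assume t: "t \<in> \<phi> ` \<C> \<inter> templates k n"
      then obtain C where CC: "C \<in> \<C>" "t = \<phi> C" by auto
      show "Ent k n t \<le> ex_ent k n P + \<epsilon> * (real n)\<^sup>2"
      proof (rule ccontr)
        assume "\<not> ?thesis"
        hence "\<delta> * real n ^ N \<le> real (card {E \<in> bad_graphs k n N (P N). E \<subseteq> Sigma (edges n) t})"
          using sup n t by auto
        also have "\<dots> = wdeg C h {}"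
          unfolding h_def using wdeg_of_bool[of C _ "{}"] finite_subset[OF C3[OF CC(1)] finV] Sig[OF CC(1)] CC(2) by simp
        also have "\<dots> < c * (real k * (real n)\<^sup>2) * (real k ^ Suc j * (real n ^ N / (real n)\<^sup>2))"
          by (rule C4[OF CC(1)])
        also have "\<dots> = (c * real k ^ Suc (Suc j)) * real n ^ N" using n by simp
        also have "\<dots> \<le> \<delta> * real n ^ N" using c(3) by (intro mult_right_mono) auto
        finally show False by simp
      qed
    next
      fix t assume t: "t \<in> templates k n" "realisations k n t \<subseteq> P n"
      have tsub: "t e \<noteq> {}" "t e \<subseteq> {1..k}" if "e \<in> edges n" for e
        using PiE_mem[OF t(1)[unfolded templates_def] that] by auto
      have "Sigma (edges n) t \<subseteq> V" using tsub(2) unfolding V_def by blast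
      moreover have "\<forall>E\<subseteq>Sigma (edges n) t. h E = 0"
        using bad_graph_not_in_template[OF t her] unfolding h_def by auto
      ultimately obtain C where CC: "C \<in> \<C>" "Sigma (edges n) t \<subseteq> C" using C5 by blast
      have sub: "t e \<subseteq> \<phi> C e" if "e \<in> edges n" for e using CC(2) that by (auto simp: \<phi>_def)
      have "\<phi> C \<in> templates k n"
        unfolding templates_def
      proof (rule PiE_I)
        show "\<phi> C e \<in> {S. S \<noteq> {} \<and> S \<subseteq> {1..k}}" if "e \<in> edges n" for e
          using sub[OF that] tsub(1)[OF that] C3[OF CC(1)] that by (auto simp: \<phi>_def V_def)
      qed (simp add: \<phi>_def)
      thus "\<exists>t'\<in>\<phi> ` \<C> \<inter> templates k n. \<forall>e\<in>edges n. t e \<subseteq> t' e" using CC(1) sub by blast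
    qed
  qed
  show ?thesis using \<alpha> main by blast
qed

section \<open>The random template\<close>

lemma exp_le_quadratic:
  fixes y :: real
  assumes "\<bar>y\<bar> \<le> 1"
  shows "exp y \<le> 1 + y + y\<^sup>2"
proof (cases "0 \<le> y")
  case True
  thus ?thesis using exp_bound[of y] assms by simp
next
  case False
  define z where "z = - y"
  have z: "0 \<le> z" using False by (simp add: z_def)
  \<comment> \<open>For negative arguments, \<open>1 - z + z ^ 2\<close> is the cofactor of
    \<open>1 + z\<close> in \<open>1 + z ^ 3\<close>, which compares it with
    \<open>exp (- z)\<close>.\<close>
  have "1 \<le> 1 + z ^ 3" using z by simp
  also have "\<dots> = (1 - z + z\<^sup>2) * (1 + z)" by (simp add: algebra_simps power2_eq_square power3_eq_cube)
  also have "\<dots> \<le> (1 - z + z\<^sup>2) * exp z"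
  proof (rule mult_left_mono)
    have "1 - z + z\<^sup>2 = (1 - z / 2)\<^sup>2 + 3 / 4 * z\<^sup>2" by (simp add: power2_eq_square algebra_simps)
    thus "0 \<le> 1 - z + z\<^sup>2" by simp
  qed simp
  finally have "exp (- z) \<le> 1 - z + z\<^sup>2" by (simp add: exp_minus field_simps)
  thus ?thesis by (simp add: z_def)
qed

text \<open>To be used with \<open>a e = log k (card (t e))\<close>: a template below
  \<open>T\<close> can have entropy only on the edges where \<open>T\<close> is full.\<close>

definition full_weight :: "nat \<Rightarrow> nat \<Rightarrow> (nat set \<Rightarrow> real) \<Rightarrow> template \<Rightarrow> real" where
  "full_weight k n a T = (\<Sum>e\<in>edges n. if T e = {1..k} then a e else 0)"

lemma finite_set_random_template: "finite (set_pmf (random_template k i n p))"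
  unfolding random_template_def by (subst set_Pi_pmf) (auto intro!: finite_PiE_dflt)

lemma random_template_values:
  assumes "T \<in> set_pmf (random_template k i n p)" "e \<in> edges n"
  shows "T e = {1..k} \<or> T e = {i}"
  using assms unfolding random_template_def by (subst (asm) set_Pi_pmf) (auto simp: PiE_dflt_def split: if_splits)

text \<open>Exponential Markov inequality, the expectation being a product over independent edges. A
  parameter \<open>l\<close> of either sign serves both tails; \<open>\<bar>l\<bar> \<le> 1\<close>
  permits the quadratic bound on \<open>exp\<close>.\<close>

lemma full_weight_tail:
  assumes k: "2 \<le> k" and p: "p \<in> {0..1}" and a: "\<And>e. e \<in> edges n \<Longrightarrow> 0 \<le> a e \<and> a e \<le> 1"
    and l: "\<bar>l\<bar> \<le> 1"
  shows "measure_pmf.prob (random_template k i n p) {T. y \<le> l * full_weight k n a T} \<le>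
    exp (p * (l * (\<Sum>e\<in>edges n. a e) + l\<^sup>2 * (real n)\<^sup>2) - y)"
proof -
  let ?M = "random_template k i n p"
  let ?f = "\<lambda>e S. exp (l * (if S = {1..k} then a e else 0))"
  \<comment> \<open>As \<open>k \<ge> 2\<close>, the two values of the random template differ, so an
    edge is full with probability exactly \<open>p\<close>.\<close>
  have ik: "{i} \<noteq> {1..k}"
  proof
    assume "{i} = {1..k}"
    moreover have "1 \<in> {1..k}" "2 \<in> {1..k}" using k by auto
    ultimately show False by (metis numeral_One one_eq_numeral_iff semiring_norm(83) singletonD)
  qed
  have "exp (l * full_weight k n a T) = (\<Prod>e\<in>edges n. ?f e (T e))" for T
    by (simp add: full_weight_def sum_distrib_left exp_sum)
  hence "measure_pmf.expectation ?M (\<lambda>T. exp (l * full_weight k n a T)) =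
      measure_pmf.expectation ?M (\<lambda>T. \<Prod>e\<in>edges n. ?f e (T e))" by simp
  also have "\<dots> = (\<Prod>e\<in>edges n. measure_pmf.expectation (map_pmf (\<lambda>b. if b then {1..k} else {i}) (bernoulli_pmf p)) (?f e))"
    unfolding random_template_def
    by (rule expectation_prod_Pi_pmf) (auto intro!: integrable_measure_pmf_finite)
  also have "\<dots> = (\<Prod>e\<in>edges n. p * exp (l * a e) + (1 - p))"
    using p ik by (intro prod.cong refl) (simp add: integral_bernoulli_pmf)
  also have "\<dots> \<le> (\<Prod>e\<in>edges n. exp (p * (l * a e + l\<^sup>2)))"
  proof (rule prod_mono, safe)
    fix e assume e: "e \<in> edges n"
    show "0 \<le> p * exp (l * a e) + (1 - p)" using p by (auto intro!: add_nonneg_nonneg)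
    have "\<bar>l * a e\<bar> \<le> 1" using l a[OF e] by (simp add: abs_mult mult_le_one)
    hence "exp (l * a e) \<le> 1 + l * a e + (l * a e)\<^sup>2" by (rule exp_le_quadratic)
    also have "(l * a e)\<^sup>2 \<le> l\<^sup>2"
      using a[OF e] mult_left_mono[of "(a e)\<^sup>2" 1 "l\<^sup>2"] by (simp add: power_mult_distrib power_le_one)
    finally have "exp (l * a e) - 1 \<le> l * a e + l\<^sup>2" by simp
    hence "p * (exp (l * a e) - 1) \<le> p * (l * a e + l\<^sup>2)" using p by (intro mult_left_mono) auto
    moreover have "p * exp (l * a e) + (1 - p) = 1 + p * (exp (l * a e) - 1)" by (simp add: algebra_simps)
    ultimately show "p * exp (l * a e) + (1 - p) \<le> exp (p * (l * a e + l\<^sup>2))"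
      using exp_ge_add_one_self[of "p * (l * a e + l\<^sup>2)"] by linarith
  qed
  also have "\<dots> = exp (p * (l * (\<Sum>e\<in>edges n. a e) + l\<^sup>2 * real (n choose 2)))"
    by (simp add: exp_sum[symmetric] sum.distrib sum_distrib_left[symmetric] card_edges mult.commute)
  also have "\<dots> \<le> exp (p * (l * (\<Sum>e\<in>edges n. a e) + l\<^sup>2 * (real n)\<^sup>2))"
  proof -
    have "n choose 2 \<le> n ^ 2" by (cases "2 \<le> n") (auto simp: binomial_le_pow binomial_eq_0)
    hence "real (n choose 2) \<le> (real n)\<^sup>2" by (metis of_nat_le_iff of_nat_power)
    hence "l\<^sup>2 * real (n choose 2) \<le> l\<^sup>2 * (real n)\<^sup>2" by (intro mult_left_mono) auto
    thus ?thesis using p by (auto intro!: mult_left_mono)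
  qed
  finally have E: "measure_pmf.expectation ?M (\<lambda>T. exp (l * full_weight k n a T)) \<le>
    exp (p * (l * (\<Sum>e\<in>edges n. a e) + l\<^sup>2 * (real n)\<^sup>2))" .
  have "measure_pmf.prob ?M {T. y \<le> l * full_weight k n a T} =
      measure_pmf.prob ?M {T \<in> space ?M. exp y \<le> exp (l * full_weight k n a T)}" by simp
  also have "\<dots> \<le> measure_pmf.expectation ?M (\<lambda>T. exp (l * full_weight k n a T)) / exp y"
    by (rule integral_Markov_inequality_measure[where A = "{}"])
      (auto intro!: integrable_measure_pmf_finite finite_set_random_template)
  also have "\<dots> \<le> exp (p * (l * (\<Sum>e\<in>edges n. a e) + l\<^sup>2 * (real n)\<^sup>2)) / exp y"
    using E by (intro divide_right_mono) auto
  finally show ?thesis by (simp add: exp_diff)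
qed

text \<open>The exponent \<open>p * n ^ 2 * (l ^ 2 - l * \<epsilon>)\<close> is smallest at
  \<open>l = \<epsilon> / 2\<close>; the lower tail takes
  \<open>l = - \<epsilon> / 2\<close>.\<close>

lemma full_weight_upper_tail:
  assumes "2 \<le> k" "p \<in> {0..1}" "\<And>e. e \<in> edges n \<Longrightarrow> 0 \<le> a e \<and> a e \<le> 1" "0 < \<epsilon>" "\<epsilon> \<le> 1"
  shows "measure_pmf.prob (random_template k i n p)
      {T. p * ((\<Sum>e\<in>edges n. a e) + \<epsilon> * (real n)\<^sup>2) \<le> full_weight k n a T} \<le> exp (- (\<epsilon>\<^sup>2 / 4 * (p * (real n)\<^sup>2)))"
proof -
  let ?s = "\<Sum>e\<in>edges n. a e"
  have "{T. p * (?s + \<epsilon> * (real n)\<^sup>2) \<le> full_weight k n a T} =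
      {T. \<epsilon> / 2 * (p * (?s + \<epsilon> * (real n)\<^sup>2)) \<le> \<epsilon> / 2 * full_weight k n a T}" using assms(4) by simp
  moreover have "p * (\<epsilon> / 2 * ?s + (\<epsilon> / 2)\<^sup>2 * (real n)\<^sup>2) - \<epsilon> / 2 * (p * (?s + \<epsilon> * (real n)\<^sup>2)) =
      - (\<epsilon>\<^sup>2 / 4 * (p * (real n)\<^sup>2))"
    by (simp add: algebra_simps power2_eq_square)
  ultimately show ?thesis
    using full_weight_tail[OF assms(1,2), where a = a and n = n and i = i and l = "\<epsilon> / 2" and y = "\<epsilon> / 2 * (p * (?s + \<epsilon> * (real n)\<^sup>2))"] assms(3,4,5) by simp
qed

lemma full_weight_lower_tail:
  assumes "2 \<le> k" "p \<in> {0..1}" "\<And>e. e \<in> edges n \<Longrightarrow> 0 \<le> a e \<and> a e \<le> 1" "0 < \<epsilon>" "\<epsilon> \<le> 1"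
  shows "measure_pmf.prob (random_template k i n p)
      {T. full_weight k n a T \<le> p * ((\<Sum>e\<in>edges n. a e) - \<epsilon> * (real n)\<^sup>2)} \<le> exp (- (\<epsilon>\<^sup>2 / 4 * (p * (real n)\<^sup>2)))"
proof -
  let ?s = "\<Sum>e\<in>edges n. a e"
  have "{T. full_weight k n a T \<le> p * (?s - \<epsilon> * (real n)\<^sup>2)} =
      {T. - (\<epsilon> / 2) * (p * (?s - \<epsilon> * (real n)\<^sup>2)) \<le> - (\<epsilon> / 2) * full_weight k n a T}" using assms(4) by simp
  moreover have "p * (- (\<epsilon> / 2) * ?s + (- (\<epsilon> / 2))\<^sup>2 * (real n)\<^sup>2) - - (\<epsilon> / 2) * (p * (?s - \<epsilon> * (real n)\<^sup>2)) =
      - (\<epsilon>\<^sup>2 / 4 * (p * (real n)\<^sup>2))"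
    by (simp add: algebra_simps power2_eq_square)
  ultimately show ?thesis
    using full_weight_tail[OF assms(1,2), where a = a and n = n and i = i and l = "- (\<epsilon> / 2)" and y = "- (\<epsilon> / 2) * (p * (?s - \<epsilon> * (real n)\<^sup>2))"] assms(3,4,5) by simp
qed

section \<open>Relative entropy in the random template\<close>

lemma recolour_set:
  assumes "colour_monotone i P" "c \<in> P n" "finite D" "D \<subseteq> edges n"
  shows "(\<lambda>e. if e \<in> D then i else c e) \<in> P n"
  using assms(3,4)
proof (induction D rule: finite_induct)
  case empty
  thus ?case using assms(2) by simp
next
  case (insert x D)
  have "(\<lambda>e. if e \<in> D then i else c e)(x := i) \<in> P n"
    using insert assms(1) unfolding colour_monotone_def by blast
  moreover have "(\<lambda>e. if e \<in> D then i else c e)(x := i) = (\<lambda>e. if e \<in> insert x D then i else c e)" by auto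
  ultimately show ?case by simp
qed

text \<open>Take \<open>t\<close> enlarged by \<open>i\<close> on the full edges and
  \<open>{i}\<close> elsewhere. Each realisation arises from one of \<open>t\<close> by recolouring
  edges to \<open>i\<close>, so monotonicity keeps it in \<open>P n\<close>. The witness
  \<open>s\<close> is returned because it also shows that the maximum in \<open>ex_ent_rel\<close>
  is over a nonempty set.\<close>

lemma full_weight_le_ex_ent_rel:
  assumes k: "2 \<le> k" and i: "i \<in> {1..k}" and mon: "colour_monotone i P"
    and t: "t \<in> templates k n" "realisations k n t \<subseteq> P n"
    and T: "\<forall>e\<in>edges n. T e = {1..k} \<or> T e = {i}"
  obtains s where "s \<in> templates k n" "\<forall>e\<in>edges n. s e \<subseteq> T e" "realisations k n s \<subseteq> P n"
    "full_weight k n (\<lambda>e. log (real k) (real (card (t e)))) T \<le> ex_ent_rel k n T P"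
proof -
  define s where "s = (\<lambda>e\<in>edges n. if T e = {1..k} then insert i (t e) else {i})"
  have tsub: "t e \<noteq> {}" "t e \<subseteq> {1..k}" if "e \<in> edges n" for e
    using PiE_mem[OF t(1)[unfolded templates_def] that] by auto
  have s1: "s \<in> templates k n"
    unfolding templates_def
  proof (rule PiE_I)
    show "s e \<in> {S. S \<noteq> {} \<and> S \<subseteq> {1..k}}" if "e \<in> edges n" for e using tsub(2)[OF that] that i by (simp add: s_def)
  qed (simp add: s_def)
  have s2: "\<forall>e\<in>edges n. s e \<subseteq> T e"
  proof
    fix e assume e: "e \<in> edges n"
    show "s e \<subseteq> T e" using T[rule_format, OF e] tsub(2)[OF e] e i by (auto simp: s_def)
  qed
  have s3: "realisations k n s \<subseteq> P n"
  proof
    fix c assume c: "c \<in> realisations k n s"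
    hence ccol: "c \<in> colourings k n" and cs: "\<And>e. e \<in> edges n \<Longrightarrow> c e \<in> s e" by (auto simp: realisations_def)
    \<comment> \<open>On \<open>D\<close> the colour of \<open>c\<close> can only be
      \<open>i\<close>, so \<open>c\<close> is \<open>c0\<close> recoloured on
      \<open>D\<close>.\<close>
    define D where "D = {e \<in> edges n. c e \<notin> t e}"
    define c0 where "c0 = (\<lambda>e. if e \<in> D then (SOME x. x \<in> t e) else c e)"
    have c0t: "c0 e \<in> t e" if "e \<in> edges n" for e
      using some_in_eq[of "t e"] tsub(1)[OF that] that by (auto simp: c0_def D_def)
    have "c0 \<in> colourings k n"
      unfolding colourings_def
    proof (rule PiE_I)
      show "c0 e \<in> {1..k}" if "e \<in> edges n" for e using c0t[OF that] tsub(2)[OF that] by blast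
      show "c0 e = undefined" if "e \<notin> edges n" for e
        using that PiE_arb[OF ccol[unfolded colourings_def] that] by (simp add: c0_def D_def)
    qed
    hence "c0 \<in> P n" using c0t t(2) by (auto simp: realisations_def)
    hence "(\<lambda>e. if e \<in> D then i else c0 e) \<in> P n" by (rule recolour_set[OF mon]) (auto simp: D_def)
    moreover have "(\<lambda>e. if e \<in> D then i else c0 e) = c"
    proof
      fix e
      show "(if e \<in> D then i else c0 e) = c e"
        using cs[of e] by (auto simp: D_def c0_def s_def split: if_splits)
    qed
    ultimately show "c \<in> P n" by simp
  qed
  have "full_weight k n (\<lambda>e. log (real k) (real (card (t e)))) T \<le> Ent k n s"
    unfolding full_weight_def Ent_def
  proof (rule sum_mono)
    fix e assume e: "e \<in> edges n"
    have fin: "finite (t e)" using tsub(2)[OF e] finite_subset by auto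
    hence "1 \<le> card (t e)" using tsub(1)[OF e] by (simp add: Suc_le_eq card_gt_0_iff)
    moreover have "card (t e) \<le> card (insert i (t e))" using fin by (intro card_mono) auto
    ultimately have "log (real k) (real (card (t e))) \<le> log (real k) (real (card (insert i (t e))))"
      using k by simp
    thus "(if T e = {1..k} then log (real k) (real (card (t e))) else 0) \<le> log (real k) (real (card (s e)))"
      using e by (simp add: s_def)
  qed
  also have "\<dots> \<le> ex_ent_rel k n T P" using ex_ent_rel_ge[of s k n T P] s1 s2 s3 by blast
  finally show thesis by (rule that[OF s1 s2 s3])
qed

text \<open>Where \<open>T\<close> is \<open>{i}\<close>, so is \<open>t'\<close>, with logarithm
  \<open>0\<close>; on the full edges \<open>t'\<close> lies below the container
  \<open>t\<close>.\<close>

lemma Ent_le_full_weight: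
  assumes k: "2 \<le> k" and t': "t' \<in> templates k n" "\<forall>e\<in>edges n. t' e \<subseteq> T e"
    and t: "t \<in> templates k n" "\<forall>e\<in>edges n. t' e \<subseteq> t e"
    and T: "\<forall>e\<in>edges n. T e = {1..k} \<or> T e = {i}"
  shows "Ent k n t' \<le> full_weight k n (\<lambda>e. log (real k) (real (card (t e)))) T"
  unfolding full_weight_def Ent_def
proof (rule sum_mono)
  fix e assume e: "e \<in> edges n"
  have t'e: "t' e \<noteq> {}" using PiE_mem[OF t'(1)[unfolded templates_def] e] by auto
  have te: "t e \<subseteq> {1..k}" using PiE_mem[OF t(1)[unfolded templates_def] e] by auto
  show "log (real k) (real (card (t' e))) \<le> (if T e = {1..k} then log (real k) (real (card (t e))) else 0)"
  proof (cases "T e = {1..k}")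
    case True
    have fin: "finite (t e)" using te finite_subset by auto
    have "card (t' e) \<le> card (t e)" using t(2) e fin by (intro card_mono) auto
    moreover have "1 \<le> card (t' e)"
      using t'e t(2) e fin finite_subset[of "t' e" "t e"] by (simp add: Suc_le_eq card_gt_0_iff)
    ultimately show ?thesis using True k by simp
  next
    case False
    hence "t' e \<subseteq> {i}" using T[rule_format, OF e] t'(2) e by auto
    hence "t' e = {i}" using t'e by blast
    thus ?thesis using False by simp
  qed
qed

text \<open>Failure forces one of \<open>card \<T> + 1\<close> events: the weight of the extremal
  template \<open>t0\<close> is too small, or that of some container is too large. In the upper
  bound one \<open>\<epsilon>\<close> covers the excess entropy of the container, the other the
  deviation.\<close>

lemma deviation_bound:
  assumes k: "2 \<le> k" and i: "i \<in> {1..k}" and her: "order_hereditary k P"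
    and mon: "colour_monotone i P" and ne: "P n \<noteq> {}" and p: "p \<in> {0..1}"
    and \<eta>: "0 < \<eta>" "\<eta> \<le> 1" "\<eta> \<le> \<epsilon>"
    and \<T>: "finite \<T>" "\<T> \<subseteq> templates k n"
    and Ent: "\<And>t. t \<in> \<T> \<Longrightarrow> Ent k n t \<le> ex_ent k n P + \<eta> * (real n)\<^sup>2"
    and cover: "\<And>t. t \<in> templates k n \<Longrightarrow> realisations k n t \<subseteq> P n \<Longrightarrow> \<exists>t'\<in>\<T>. \<forall>e\<in>edges n. t e \<subseteq> t' e"
  shows "1 - (real (card \<T>) + 1) * exp (- (\<eta>\<^sup>2 / 4 * (p * (real n)\<^sup>2))) \<le>
    measure_pmf.prob (random_template k i n p)
      {T. p * (ex_ent k n P - \<epsilon> * (real n)\<^sup>2) \<le> ex_ent_rel k n T P \<and>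
          ex_ent_rel k n T P \<le> p * (ex_ent k n P + 2 * \<epsilon> * (real n)\<^sup>2)}"
proof -
  let ?M = "random_template k i n p"
  let ?G = "{T. p * (ex_ent k n P - \<epsilon> * (real n)\<^sup>2) \<le> ex_ent_rel k n T P \<and>
          ex_ent_rel k n T P \<le> p * (ex_ent k n P + 2 * \<epsilon> * (real n)\<^sup>2)}"
  let ?x = "exp (- (\<eta>\<^sup>2 / 4 * (p * (real n)\<^sup>2)))"
  define a where "a = (\<lambda>t e. log (real k) (real (card ((t :: template) e))))"
  have "P n \<subseteq> colourings k n" using her by (simp add: order_hereditary_def)
  then obtain t0 where t0: "t0 \<in> templates k n" "realisations k n t0 \<subseteq> P n" "ex_ent k n P = Ent k n t0"
    using ne by (rule ex_ent_attained)
  have a01: "0 \<le> a t e \<and> a t e \<le> 1" if "t \<in> templates k n" "e \<in> edges n" for t e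
    using log_card_bounds[OF k, of "t e"] PiE_mem[OF that(1)[unfolded templates_def] that(2)]
    by (auto simp: a_def)
  have Ent_a: "Ent k n t = (\<Sum>e\<in>edges n. a t e)" for t by (simp add: Ent_def a_def)
  define L where "L = {T. full_weight k n (a t0) T \<le> p * ((\<Sum>e\<in>edges n. a t0 e) - \<eta> * (real n)\<^sup>2)}"
  define U where "U = (\<lambda>t. {T. p * ((\<Sum>e\<in>edges n. a t e) + \<eta> * (real n)\<^sup>2) \<le> full_weight k n (a t) T})"
  have pL: "measure_pmf.prob ?M L \<le> ?x"
    unfolding L_def by (rule full_weight_lower_tail[OF k p _ \<eta>(1,2)]) (rule a01[OF t0(1)])
  have pU: "measure_pmf.prob ?M (U t) \<le> ?x" if "t \<in> \<T>" for t
    unfolding U_def using that \<T>(2) by (intro full_weight_upper_tail[OF k p _ \<eta>(1,2)] a01) auto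
  have sub: "- ?G \<inter> set_pmf ?M \<subseteq> L \<union> (\<Union>t\<in>\<T>. U t)"
  proof
    fix T assume T: "T \<in> - ?G \<inter> set_pmf ?M"
    have Tv: "\<forall>e\<in>edges n. T e = {1..k} \<or> T e = {i}"
      using random_template_values T by blast
    obtain s where s: "s \<in> templates k n" "\<forall>e\<in>edges n. s e \<subseteq> T e" "realisations k n s \<subseteq> P n"
      "full_weight k n (a t0) T \<le> ex_ent_rel k n T P"
      unfolding a_def using k i mon t0(1,2) Tv by (rule full_weight_le_ex_ent_rel)
    obtain t' where t': "t' \<in> templates k n" "\<forall>e\<in>edges n. t' e \<subseteq> T e" "realisations k n t' \<subseteq> P n"
      "ex_ent_rel k n T P = Ent k n t'"
      using s(1-3) by (rule ex_ent_rel_attained)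
    obtain t where t: "t \<in> \<T>" "\<forall>e\<in>edges n. t' e \<subseteq> t e" using cover[OF t'(1,3)] by blast
    have tt: "t \<in> templates k n" using t(1) \<T>(2) by blast
    have up: "ex_ent_rel k n T P \<le> full_weight k n (a t) T"
      unfolding t'(4) a_def by (rule Ent_le_full_weight[OF k t'(1,2) tt t(2) Tv])
    have n2: "\<eta> * (real n)\<^sup>2 \<le> \<epsilon> * (real n)\<^sup>2" using \<eta> by (intro mult_right_mono) auto
    show "T \<in> L \<union> (\<Union>t\<in>\<T>. U t)"
    proof (cases "p * (ex_ent k n P - \<epsilon> * (real n)\<^sup>2) \<le> ex_ent_rel k n T P")
      case False
      have "full_weight k n (a t0) T \<le> p * (ex_ent k n P - \<epsilon> * (real n)\<^sup>2)" using False s(4) by linarith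
      also have "\<dots> \<le> p * (ex_ent k n P - \<eta> * (real n)\<^sup>2)" using p n2 by (intro mult_left_mono) auto
      finally show ?thesis by (simp add: L_def t0(3) Ent_a)
    next
      case True
      have "p * (Ent k n t + \<eta> * (real n)\<^sup>2) \<le> p * (ex_ent k n P + 2 * \<epsilon> * (real n)\<^sup>2)"
        using p n2 Ent[OF t(1)] by (intro mult_left_mono) auto
      also have "\<dots> \<le> ex_ent_rel k n T P" using T True by auto
      also note up
      finally have "T \<in> U t" by (simp add: U_def Ent_a)
      thus ?thesis using t(1) by blast
    qed
  qed
  have "measure_pmf.prob ?M (- ?G) = measure_pmf.prob ?M (- ?G \<inter> set_pmf ?M)"
    by (rule measure_Int_set_pmf[symmetric])
  also have "\<dots> \<le> measure_pmf.prob ?M (L \<union> (\<Union>t\<in>\<T>. U t))"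
    using sub by (intro measure_pmf.finite_measure_mono) auto
  also have "\<dots> \<le> measure_pmf.prob ?M L + measure_pmf.prob ?M (\<Union>t\<in>\<T>. U t)"
    by (intro measure_Un_le) auto
  also have "measure_pmf.prob ?M (\<Union>t\<in>\<T>. U t) \<le> (\<Sum>t\<in>\<T>. measure_pmf.prob ?M (U t))"
    by (intro measure_UNION_le \<T>(1)) auto
  also have "\<dots> \<le> real (card \<T>) * ?x" using pU by (rule sum_bounded_above)
  finally have "measure_pmf.prob ?M (- ?G) \<le> (real (card \<T>) + 1) * ?x" using pL by (simp add: algebra_simps)
  moreover have "measure_pmf.prob ?M (- ?G) = 1 - measure_pmf.prob ?M ?G"
    using measure_pmf.prob_compl[of ?G ?M] by (simp add: Compl_eq_Diff_UNIV)
  ultimately show ?thesis by linarith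
qed

text \<open>\<open>b\<close> is \<open>k * n ^ 2\<close> times the fingerprint density
  \<open>n powr (- 2 * s)\<close>, rounded up. The second claim rests on
  \<open>2 * s * j = 2 * j / (2 * j + 1) \<le> 1\<close>; the last one makes \<open>b / v\<close>
  tend to \<open>0\<close>.\<close>

lemma fingerprint_size:
  fixes k j n :: nat
  assumes k: "2 \<le> k" and n: "1 \<le> n"
  defines "s \<equiv> 1 / (2 * real j + 1)"
  defines "b \<equiv> nat \<lceil>real k * real n powr (2 - 2 * s)\<rceil>"
  shows "1 \<le> b" "1 / real n \<le> (real b / (real k * (real n)\<^sup>2)) ^ j"
    "real b \<le> (real k + 1) * real n powr (2 - 2 * s)"
    "real b / (real k * (real n)\<^sup>2) \<le> 2 * real n powr (- 2 * s)"
proof -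
  let ?y = "real n powr (2 - 2 * s)"
  have s: "0 < s" "s \<le> 1" by (auto simp: s_def)
  \<comment> \<open>Absorbs the rounding error \<open>1\<close> into one more copy of
    \<open>?y\<close>.\<close>
  have y1: "1 \<le> ?y" using n s by (intro ge_one_powr_ge_zero) auto
  have lb: "real k * ?y \<le> real b" unfolding b_def by (rule real_nat_ceiling_ge)
  have "0 < real k * ?y" using k n by simp
  thus "1 \<le> b" using lb by (cases "b = 0") auto
  have "real b = of_int \<lceil>real k * ?y\<rceil>" unfolding b_def by simp
  hence "real b \<le> real k * ?y + 1" using of_int_ceiling_le_add_one[of "real k * ?y"] by linarith
  thus ub: "real b \<le> (real k + 1) * ?y" using y1 by (simp add: algebra_simps)
  have y2: "?y = real n powr (- 2 * s) * (real n)\<^sup>2"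
    using n by (simp add: powr_diff powr_minus field_simps)
  have pos: "0 < real k * (real n)\<^sup>2" using k n by simp
  have "real n powr (- 2 * s) \<le> real b / (real k * (real n)\<^sup>2)"
    using lb pos unfolding y2 by (simp add: pos_le_divide_eq mult_ac)
  hence "(real n powr (- 2 * s)) ^ j \<le> (real b / (real k * (real n)\<^sup>2)) ^ j" by (intro power_mono) auto
  moreover have "1 / real n \<le> (real n powr (- 2 * s)) ^ j"
  proof -
    have "1 / real n = real n powr (- 1)" using n by (simp add: powr_minus_divide)
    also have "\<dots> \<le> real n powr (- 2 * s * real j)"
      using n by (intro powr_mono) (auto simp: s_def field_simps)
    also have "\<dots> = (real n powr (- 2 * s)) ^ j" using n by (simp add: powr_power mult_ac)
    finally show ?thesis .
  qed
  ultimately show "1 / real n \<le> (real b / (real k * (real n)\<^sup>2)) ^ j" by linarith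
  have "(real k + 1) * ?y \<le> (2 * real k) * ?y" using k by (intro mult_right_mono) auto
  hence "real b \<le> 2 * real n powr (- 2 * s) * (real k * (real n)\<^sup>2)" using ub unfolding y2 by (simp add: mult_ac)
  thus "real b / (real k * (real n)\<^sup>2) \<le> 2 * real n powr (- 2 * s)" using pos by (simp add: pos_divide_le_eq)
qed

text \<open>The exponent is the logarithm of the container count minus the Chernoff exponent, with
  the common power of \<open>n\<close> taken out; \<open>n powr s\<close> beats the
  logarithm.\<close>

lemma union_bound_tendsto_0:
  fixes C c s K :: real
  assumes s: "0 < s" "s \<le> 1" and c: "0 < c" and K: "0 < K"
  shows "(\<lambda>n. 2 * exp (real n powr (2 - 2 * s) * (C * ln (K * (real n)\<^sup>2 + 1) - c * real n powr s))) \<longlonglongrightarrow> 0"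
proof -
  have "filterlim (\<lambda>n. C * ln (K * (real n)\<^sup>2 + 1) - c * real n powr s) at_bot sequentially"
    using s c K by real_asymp
  \<comment> \<open>Once the bracket is nonpositive, the factor
    \<open>n powr (2 - 2 * s) \<ge> 1\<close> only lowers it.\<close>
  moreover have "eventually (\<lambda>n. real n powr (2 - 2 * s) * (C * ln (K * (real n)\<^sup>2 + 1) - c * real n powr s)
      \<le> C * ln (K * (real n)\<^sup>2 + 1) - c * real n powr s) sequentially"
  proof -
    have "eventually (\<lambda>n. C * ln (K * (real n)\<^sup>2 + 1) - c * real n powr s \<le> 0) sequentially"
      using calculation unfolding filterlim_at_bot by (rule spec)
    moreover have "eventually (\<lambda>n. 1 \<le> n) sequentially" by (rule eventually_ge_at_top)
    ultimately show ?thesis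
    proof eventually_elim
      case (elim n)
      have "1 \<le> real n powr (2 - 2 * s)" using elim(2) s by (intro ge_one_powr_ge_zero) auto
      thus ?case using mult_right_mono_neg[OF _ elim(1), of 1 "real n powr (2 - 2 * s)"] by simp
    qed
  qed
  ultimately have "filterlim (\<lambda>n. real n powr (2 - 2 * s) * (C * ln (K * (real n)\<^sup>2 + 1) - c * real n powr s)) at_bot sequentially"
    by (rule filterlim_at_bot_mono)
  hence "(\<lambda>n. exp (real n powr (2 - 2 * s) * (C * ln (K * (real n)\<^sup>2 + 1) - c * real n powr s))) \<longlonglongrightarrow> 0"
    by (rule filterlim_compose[OF exp_at_bot])
  from tendsto_mult_left[OF this, of 2] show ?thesis by simp
qed

text \<open>Serves the degenerate case \<open>N < 2\<close>: there the exponent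
  \<open>- 1 / (2 * 0 - 1)\<close> equals \<open>1\<close>, so the assumption on \<open>p\<close>
  makes \<open>n\<close> small against a bounded function, a contradiction.\<close>

lemma real_not_small_o_of_bounded:
  assumes "\<And>n. p n \<in> {0..1::real}"
  shows "(\<lambda>n. real n) \<notin> o(p)"
proof
  assume "(\<lambda>n. real n) \<in> o(p)"
  hence "eventually (\<lambda>n. norm (real n) \<le> 1 * norm (p n)) sequentially" by (rule landau_o.smallD) simp
  moreover have "eventually (\<lambda>n::nat. 2 \<le> n) sequentially" by (rule eventually_ge_at_top)
  ultimately have "eventually (\<lambda>n::nat. False) sequentially"
  proof eventually_elim
    case (elim n)
    thus ?case using assms[of n] by simp
  qed
  thus False by simp
qed

theorem theorem2p24:
  fixes k i N :: nat and P :: "nat \<Rightarrow> colouring set"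
    and p :: "nat \<Rightarrow> real" and \<epsilon> :: real
  assumes "k \<ge> 2" and "i \<in> {1..k}"
    and "order_hereditary k P"
    and "colour_monotone i P"
    and "defined_by_forbidden k N P"
    and "\<And>n. P n \<noteq> {}"
    and "\<And>n. p n \<in> {0..1}"
    and "(\<lambda>n. real n powr (- 1 / (2 * real (N choose 2) - 1))) \<in> o(p)"
    and "\<epsilon> > 0"
  shows "(\<lambda>n. measure_pmf.prob (random_template k i n (p n))
            {T. p n * (ex_ent k n P - \<epsilon> * (real n)^2) \<le> ex_ent_rel k n T P \<and>
                ex_ent_rel k n T P \<le> p n * (ex_ent k n P + 2 * \<epsilon> * (real n)^2)})
         \<longlonglongrightarrow> 1"
proof (cases "N choose 2")
  case 0
  have "(\<lambda>n. real n powr (- 1 / (2 * real (N choose 2) - 1))) = real" unfolding 0 by (intro ext) simp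
  hence "real \<in> o(p)" using assms(8) by simp
  thus ?thesis using real_not_small_o_of_bounded[OF assms(7)] by simp
next
  case (Suc j)
  let ?pr = "\<lambda>n. measure_pmf.prob (random_template k i n (p n))
            {T. p n * (ex_ent k n P - \<epsilon> * (real n)^2) \<le> ex_ent_rel k n T P \<and>
                ex_ent_rel k n T P \<le> p n * (ex_ent k n P + 2 * \<epsilon> * (real n)^2)}"
  define s where "s = 1 / (2 * real j + 1)"
  \<comment> \<open>The tail bounds are stated for deviations of at most \<open>1\<close>.\<close>
  define \<eta> where "\<eta> = min \<epsilon> 1"
  define b where "b = (\<lambda>n. nat \<lceil>real k * real n powr (2 - 2 * s)\<rceil>)"
  have s: "0 < s" "s \<le> 1" by (auto simp: s_def)
  have \<eta>: "0 < \<eta>" "\<eta> \<le> 1" "\<eta> \<le> \<epsilon>" using assms(9) by (auto simp: \<eta>_def)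
  obtain \<alpha> L M where \<alpha>: "0 < \<alpha>" and cont: "\<forall>n\<ge>M. \<forall>b\<ge>1. real b / (real k * (real n)\<^sup>2) \<le> \<alpha> \<longrightarrow>
      1 / real n \<le> (real b / (real k * (real n)\<^sup>2)) ^ j \<longrightarrow>
    (\<exists>\<T>. finite \<T> \<and> \<T> \<subseteq> templates k n \<and> card \<T> \<le> (k * n\<^sup>2 + 1) ^ (b * j * L) \<and>
      (\<forall>t\<in>\<T>. Ent k n t \<le> ex_ent k n P + \<eta> * (real n)\<^sup>2) \<and>
      (\<forall>t\<in>templates k n. realisations k n t \<subseteq> P n \<longrightarrow> (\<exists>t'\<in>\<T>. \<forall>e\<in>edges n. t e \<subseteq> t' e)))"
    using template_containers[OF assms(1,3,5,6) Suc \<eta>(1)] by blast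
  \<comment> \<open>\<open>C * n powr (2 - 2 * s)\<close> bounds the exponent
    \<open>b * j * L\<close> in the number of containers.\<close>
  define C where "C = (real k + 1) * real j * real L"
  define f where "f = (\<lambda>n. 2 * exp (real n powr (2 - 2 * s) * (C * ln (real k * (real n)\<^sup>2 + 1) - \<eta>\<^sup>2 / 4 * real n powr s)))"
  have f0: "f \<longlonglongrightarrow> 0" unfolding f_def using s \<eta> assms(1) by (intro union_bound_tendsto_0) auto
  have exponent: "- 1 / (2 * real (N choose 2) - 1) = - s" unfolding Suc s_def by simp
  have ev_p: "eventually (\<lambda>n. real n powr (- s) \<le> p n) sequentially"
  proof -
    have "eventually (\<lambda>n. norm (real n powr (- s)) \<le> 1 * norm (p n)) sequentially"
      using assms(8) unfolding exponent by (rule landau_o.smallD) simp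
    thus ?thesis
    proof eventually_elim
      case (elim n)
      thus ?case using assms(7)[of n] by simp
    qed
  qed
  have ev_\<alpha>: "eventually (\<lambda>n. 2 * real n powr (- 2 * s) \<le> \<alpha>) sequentially"
  proof -
    have "(\<lambda>n. 2 * real n powr (- 2 * s)) \<longlonglongrightarrow> 0" using s by real_asymp
    hence "eventually (\<lambda>n. 2 * real n powr (- 2 * s) < \<alpha>) sequentially" using \<alpha> by (rule order_tendstoD(2))
    thus ?thesis by (rule eventually_mono) simp
  qed
  have lower: "eventually (\<lambda>n. 1 - f n \<le> ?pr n) sequentially"
    using ev_p ev_\<alpha> eventually_ge_at_top[of "max M 1"]
  proof eventually_elim
    case (elim n)
    have n: "M \<le> n" "1 \<le> n" using elim(3) by auto
    have bn: "b n = nat \<lceil>real k * real n powr (2 - 2 * s)\<rceil>" by (simp add: b_def)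
    note b = fingerprint_size[OF assms(1) n(2), of j, folded s_def, folded bn]
    have "real (b n) / (real k * (real n)\<^sup>2) \<le> \<alpha>" using b(4) elim(2) by linarith
    from cont[rule_format, OF n(1) b(1) this b(2)] obtain \<T> where T0: "finite \<T> \<and> \<T> \<subseteq> templates k n \<and>
        card \<T> \<le> (k * n\<^sup>2 + 1) ^ (b n * j * L) \<and>
        (\<forall>t\<in>\<T>. Ent k n t \<le> ex_ent k n P + \<eta> * (real n)\<^sup>2) \<and>
        (\<forall>t\<in>templates k n. realisations k n t \<subseteq> P n \<longrightarrow> (\<exists>t'\<in>\<T>. \<forall>e\<in>edges n. t e \<subseteq> t' e))"
      by (rule exE)
    let ?z = "real k * (real n)\<^sup>2 + 1" and ?y = "real n powr (2 - 2 * s)"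
    have z: "1 \<le> ?z" by simp
    have "real (card \<T>) \<le> ?z ^ (b n * j * L)"
      using of_nat_mono[of "card \<T>" "(k * n\<^sup>2 + 1) ^ (b n * j * L)", where ?'a = real] T0 by (simp add: add_ac)
    also have "\<dots> = exp (real (b n * j * L) * ln ?z)" by (simp only: exp_of_nat_mult exp_ln[OF less_le_trans[OF zero_less_one z]])
    also have "\<dots> \<le> exp (?y * (C * ln ?z))"
    proof -
      have "real (b n) * (real j * real L * ln ?z) \<le> ((real k + 1) * ?y) * (real j * real L * ln ?z)"
        using b(3) by (intro mult_right_mono mult_nonneg_nonneg ln_ge_zero) auto
      thus ?thesis by (simp add: C_def mult_ac)
    qed
    finally have c\<T>: "real (card \<T>) \<le> exp (?y * (C * ln ?z))" .
    have C0: "0 \<le> C" by (simp add: C_def)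
    hence "0 \<le> ?y * (C * ln ?z)" by (intro mult_nonneg_nonneg ln_ge_zero) auto
    hence "1 \<le> exp (?y * (C * ln ?z))" by simp
    \<comment> \<open>The summand \<open>1\<close> belongs to the lower-tail event.\<close>
    with c\<T> have c1: "real (card \<T>) + 1 \<le> 2 * exp (?y * (C * ln ?z))" by linarith
    \<comment> \<open>The Chernoff exponent is of order at least \<open>n powr (2 - s)\<close>,
      which exceeds the scale \<open>?y\<close> of the fingerprints by the factor
      \<open>n powr s\<close>.\<close>
    have "?y * real n powr s = real n powr (- s) * (real n)\<^sup>2"
    proof -
      have "?y * real n powr s = real n powr (2 - s)" by (simp add: powr_add[symmetric])
      also have "\<dots> = real n powr (- s) * real n powr 2" by (subst powr_add[symmetric]) simp
      finally show ?thesis using n by simp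
    qed
    also have "\<dots> \<le> p n * (real n)\<^sup>2" using elim(1) by (intro mult_right_mono) auto
    finally have pn: "?y * real n powr s \<le> p n * (real n)\<^sup>2" .
    have "\<eta>\<^sup>2 / 4 * (?y * real n powr s) \<le> \<eta>\<^sup>2 / 4 * (p n * (real n)\<^sup>2)"
      using pn by (intro mult_left_mono) auto
    hence "exp (- (\<eta>\<^sup>2 / 4 * (p n * (real n)\<^sup>2))) \<le> exp (- (\<eta>\<^sup>2 / 4 * (?y * real n powr s)))" by simp
    with c1 have "(real (card \<T>) + 1) * exp (- (\<eta>\<^sup>2 / 4 * (p n * (real n)\<^sup>2))) \<le>
        (2 * exp (?y * (C * ln ?z))) * exp (- (\<eta>\<^sup>2 / 4 * (?y * real n powr s)))"
      by (intro mult_mono) auto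
    also have "\<dots> = f n"
    proof -
      have "?y * (C * ln ?z) + - (\<eta>\<^sup>2 / 4 * (?y * real n powr s)) = ?y * (C * ln ?z - \<eta>\<^sup>2 / 4 * real n powr s)"
        by (simp add: algebra_simps)
      thus ?thesis unfolding f_def by (simp only: mult.assoc exp_add[symmetric])
    qed
    finally have "(real (card \<T>) + 1) * exp (- (\<eta>\<^sup>2 / 4 * (p n * (real n)\<^sup>2))) \<le> f n" .
    moreover have "1 - (real (card \<T>) + 1) * exp (- (\<eta>\<^sup>2 / 4 * (p n * (real n)\<^sup>2))) \<le> ?pr n"
    proof (rule deviation_bound[OF assms(1-4) assms(6,7) \<eta>])
      show "finite \<T>" "\<T> \<subseteq> templates k n" using T0 by (blast, blast)
      show "Ent k n t \<le> ex_ent k n P + \<eta> * (real n)\<^sup>2" if "t \<in> \<T>" for t using T0 that by blast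
      show "\<exists>t'\<in>\<T>. \<forall>e\<in>edges n. t e \<subseteq> t' e" if "t \<in> templates k n" "realisations k n t \<subseteq> P n" for t
        using T0 that by blast
    qed
    ultimately show ?case by linarith
  qed
  have "(\<lambda>n. 1 - f n) \<longlonglongrightarrow> 1" using tendsto_diff[OF tendsto_const[of 1] f0] by simp
  from tendsto_sandwich[OF lower _ this tendsto_const] show ?thesis by simp
qed

end
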